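(* Let $\sigma_L,\sigma_R>0$ and $\gamma^L,\gamma^R\in\mathbb{R}$, and let $u^L_0$ on $(-\infty,0)$ and $u^R_0$ on $(0,\infty)$ be given initial data. Let $(u^L,u^R)$ be the solution (in the sense of the context) of $$u^L_t=\sigma_L^2u^L_{xx}\ (x<0,\ t>0),\qquad u^R_t=\sigma_R^2u^R_{xx}\ (x>0,\ t>0),$$ $$u^L(x,0)=u^L_0(x)\ (x<0),\qquad u^R(x,0)=u^R_0(x)\ (x>0),$$ $$\lim_{x\to-\infty}u^L(x,t)=\gamma^L,\qquad \lim_{x\to\infty}u^R(x,t)=\gamma^R\qquad (t\ge 0),$$ $$u^L(0,t)=u^R(0,t),\qquad \sigma_L^2u^L_x(0,t)=\sigma_R^2u^R_x(0,t)\qquad (t>0).$$ Then for $x<0$, $t>0$, $$\begin{aligned}u^L(x,t)=\;&\gamma^L+\frac{\sigma_R(\gamma^R-\gamma^L)}{\sigma_L+\sigma_R}\left(1+\operatorname{erf}\left(\frac{x}{2\sqrt{\sigma_L^2t}}\right)\right)+\frac1{2\pi}\int_{-\infty}^\infty e^{ikx-(\sigma_Lk)^2t}\,\hat v^L_0(k)\,dk\\&+\int_{\partial D^-}\frac{\sigma_R-\sigma_L}{2\pi(\sigma_L+\sigma_R)}e^{ikx-(\sigma_Lk)^2t}\,\hat v^L_0(-k)\,dk-\int_{\partial D^-}\frac{\sigma_L}{\pi(\sigma_L+\sigma_R)}e^{ikx-(\sigma_Lk)^2t}\,\hat v^R_0(k\sigma_L/\sigma_R)\,dk,\end{aligned}$$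 and for $x>0$, $t>0$, $$\begin{aligned}u^R(x,t)=\;&\gamma^R+\frac{\sigma_L(\gamma^L-\gamma^R)}{\sigma_L+\sigma_R}\left(1-\operatorname{erf}\left(\frac{x}{2\sqrt{\sigma_R^2t}}\right)\right)+\frac1{2\pi}\int_{-\infty}^\infty e^{ikx-(\sigma_Rk)^2t}\,\hat v^R_0(k)\,dk\\&+\int_{\partial D^+}\frac{\sigma_R-\sigma_L}{2\pi(\sigma_L+\sigma_R)}e^{ikx-(\sigma_Rk)^2t}\,\hat v^R_0(-k)\,dk+\int_{\partial D^+}\frac{\sigma_R}{\pi(\sigma_L+\sigma_R)}e^{ikx-(\sigma_Rk)^2t}\,\hat v^L_0(k\sigma_R/\sigma_L)\,dk.\end{aligned}$$
   Context: Notation: $\operatorname{erf}(z)=\frac{2}{\sqrt\pi}\int_0^z e^{-y^2}\,dy$. Put $v^L_0=u^L_0-\gamma^L$, $v^R_0=u^R_0-\gamma^R$, and $$\hat v^L_0(k)=\int_{-\infty}^0e^{-ikx}v^L_0(x)\,dx\ (\operatorname{Im}k\ge0),\qquad \hat v^R_0(k)=\int_0^\infty e^{-ikx}v^R_0(x)\,dx\ (\operatorname{Im}k\le0).$$ Contours: $D=\{k\in\mathbb{C}:\operatorname{Re}(k^2)<0\}=D^+\cup D^-$, where $D^+$ and $D^-$ are the parts of $D$ in the upper and lower half-plane. Boundaries are oriented with the region on the left: $\partial D^+$ runs from $\infty e^{3\pi i/4}$ to $0$ to $\infty e^{i\pi/4}$, and $\partial D^-$ runs from $\infty e^{-i\pi/4}$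 to $0$ to $\infty e^{-3\pi i/4}$. Standing regularity and decay conventions: $v_0^L,v_0^R$ are integrable. A solution is a classical one: for $t>0$, $u^L$ (resp. $u^R$) is $C^1$ in $t$ and $C^2$ in $x$ in the open domain, and $u$, $u_x$ extend continuously to $x=0$, with $u(0,\cdot)$ and $u_x(0,\cdot)$ integrable on $(0,T)$ for every $T>0$. With $v^L=u^L-\gamma^L$, $v^R=u^R-\gamma^R$, the map $t\mapsto v(\cdot,t)$ is continuous from $[0,\infty)$ into $L^1$ (so that the initial condition is attained), and $v,v_x\to0$ as $|x|\to\infty$ uniformly for $t$ in compact subsets of $(0,\infty)$. *)

theory Defs
  imports "HOL-Analysis.Analysis"
begin

text \<open>The interval integral is oriented, so this is also the right value for negative \<open>z\<close>.\<close>

definition erf :: "real \<Rightarrow> real" where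
  "erf z = 2 / sqrt pi * (LBINT y=0..ereal z. exp (- y\<^sup>2))"

text \<open>
  The transform \<open>k \<mapsto> \<integral>\<^sub>S exp (- i k x) v x dx\<close>, for complex \<open>k\<close>. For integrable \<open>v\<close> the integral
  converges if \<open>S = {..<0}\<close> and \<open>Im k \<ge> 0\<close>, or if \<open>S = {0<..}\<close> and \<open>Im k \<le> 0\<close>; it is only used
  for such \<open>k\<close>.
\<close>

definition half_line_transform :: "real set \<Rightarrow> (real \<Rightarrow> real) \<Rightarrow> complex \<Rightarrow> complex" where
  "half_line_transform S v k =
     (LINT x:S|lebesgue. exp (- (\<i> * k * of_real x)) * of_real (v x))"

text \<open>
  \<open>ray_integral \<theta> f\<close> is the integral of \<open>f\<close> along the ray from \<open>0\<close> to \<open>\<infinity> e\<^sup>i\<^sup>\<theta>\<close>, with the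
  parametrisation \<open>k = r e\<^sup>i\<^sup>\<theta>\<close>.
\<close>

definition ray_integral :: "real \<Rightarrow> (complex \<Rightarrow> complex) \<Rightarrow> complex" where
  "ray_integral \<theta> f = (LINT r:{0<..}|lborel. f (of_real r * cis \<theta>) * cis \<theta>)"

text \<open>
  The boundaries of the two components of \<open>D = {k. Re (k\<^sup>2) < 0}\<close>, oriented with \<open>D\<close> on the left:
  the contour in the upper half-plane runs from \<open>\<infinity> e\<^bsup>3\<pi>i/4\<^esup>\<close> through \<open>0\<close> to \<open>\<infinity> e\<^bsup>\<pi>i/4\<^esup>\<close>, the one in
  the lower half-plane from \<open>\<infinity> e\<^bsup>-\<pi>i/4\<^esup>\<close> through \<open>0\<close> to \<open>\<infinity> e\<^bsup>-3\<pi>i/4\<^esup>\<close>. An incoming ray is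
  traversed backwards and thus contributes with a minus sign.
\<close>

definition integral_bdry_D_upper :: "(complex \<Rightarrow> complex) \<Rightarrow> complex" where
  "integral_bdry_D_upper f = ray_integral (pi / 4) f - ray_integral (3 * pi / 4) f"

definition integral_bdry_D_lower :: "(complex \<Rightarrow> complex) \<Rightarrow> complex" where
  "integral_bdry_D_lower f = ray_integral (- (3 * pi / 4)) f - ray_integral (- (pi / 4)) f"

text \<open>
  Classical solutions of \<open>u\<^sub>t = \<sigma>\<^sup>2 u\<^sub>x\<^sub>x\<close> on an open half-line \<open>S\<close> with boundary point \<open>0\<close>, with initial
  datum \<open>u0\<close> and far-field value \<open>\<gamma>\<close>. The filter \<open>F\<close> describes the infinite end of \<open>S\<close>: it is
  \<^const>\<open>at_bot\<close> for \<open>{..<0}\<close> and \<^const>\<open>at_top\<close> for \<open>{0<..}\<close>. The function \<open>ux\<close> is the spatial derivative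
  in \<open>S\<close>; \<open>u 0 t\<close> and \<open>ux 0 t\<close> are the values of the continuous extensions to the boundary.
\<close>

definition half_line_heat_solution ::
  "real set \<Rightarrow> real filter \<Rightarrow> real \<Rightarrow> real \<Rightarrow> (real \<Rightarrow> real) \<Rightarrow>
     (real \<Rightarrow> real \<Rightarrow> real) \<Rightarrow> (real \<Rightarrow> real \<Rightarrow> real) \<Rightarrow> bool" where
  "half_line_heat_solution S F \<sigma> \<gamma> u0 u ux \<longleftrightarrow>
     (\<exists>ut uxx.
        (\<forall>x\<in>S. \<forall>t>0.
           ((\<lambda>s. u x s) has_real_derivative ut x t) (at t) \<and>
           ((\<lambda>y. u y t) has_real_derivative ux x t) (at x) \<and>
           ((\<lambda>y. ux y t) has_real_derivative uxx x t) (at x) \<and>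
           ut x t = \<sigma>\<^sup>2 * uxx x t) \<and>
        continuous_on (S \<times> {0<..}) (\<lambda>(x, t). ut x t) \<and>
        continuous_on (S \<times> {0<..}) (\<lambda>(x, t). uxx x t)) \<and>
     continuous_on (closure S \<times> {0<..}) (\<lambda>(x, t). u x t) \<and>
     continuous_on (closure S \<times> {0<..}) (\<lambda>(x, t). ux x t) \<and>
     (\<forall>T>0. (\<lambda>t. u 0 t) absolutely_integrable_on {0<..<T}) \<and>
     (\<forall>T>0. (\<lambda>t. ux 0 t) absolutely_integrable_on {0<..<T}) \<and>
     (\<forall>x\<in>S. u x 0 = u0 x) \<and>
     (\<forall>t\<ge>0. (\<lambda>x. u x t - \<gamma>) absolutely_integrable_on S) \<and>
     (\<forall>t\<ge>0. ((\<lambda>s. LINT x:S|lebesgue. \<bar>(u x s - \<gamma>) - (u x t - \<gamma>)\<bar>) \<longlongrightarrow> 0) (at t within {0..})) \<and>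
     (\<forall>t\<ge>0. ((\<lambda>x. u x t) \<longlongrightarrow> \<gamma>) F) \<and>
     (\<forall>K. compact K \<and> K \<subseteq> {0<..} \<longrightarrow>
        uniform_limit K (\<lambda>x t. u x t - \<gamma>) (\<lambda>_. 0) F \<and>
        uniform_limit K (\<lambda>x t. ux x t) (\<lambda>_. 0) F)"

definition heat_interface_solution ::
  "real \<Rightarrow> real \<Rightarrow> real \<Rightarrow> real \<Rightarrow> (real \<Rightarrow> real) \<Rightarrow> (real \<Rightarrow> real) \<Rightarrow>
     (real \<Rightarrow> real \<Rightarrow> real) \<Rightarrow> (real \<Rightarrow> real \<Rightarrow> real) \<Rightarrow> bool" where
  "heat_interface_solution \<sigma>L \<sigma>R \<gamma>L \<gamma>R u0L u0R uL uR \<longleftrightarrow>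
     (\<exists>uLx uRx.
        half_line_heat_solution {..<0} at_bot \<sigma>L \<gamma>L u0L uL uLx \<and>
        half_line_heat_solution {0<..} at_top \<sigma>R \<gamma>R u0R uR uRx \<and>
        (\<forall>t>0. uL 0 t = uR 0 t \<and> \<sigma>L\<^sup>2 * uLx 0 t = \<sigma>R\<^sup>2 * uRx 0 t))"

end

theory Submission
  imports Defs "HOL-Complex_Analysis.Complex_Analysis" "HOL-Probability.Probability"
begin

text \<open>
  Green's identity on a single half-line, with the heat kernel \<open>K(y + c, T - s)\<close> as test function and
  \<open>c \<noteq> 0\<close>, expresses \<open>v(-c, T)\<close> if \<open>c < 0\<close>, and \<open>0\<close> if \<open>c > 0\<close>, by the initial datum and by the
  integrals of the boundary values \<open>v(0, s)\<close> and \<open>v\<^sub>x(0, s)\<close> against \<open>K(c, T - s)\<close> and its derivative.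
  The left half-line is reflected to the right one. For \<open>x > 0\<close>, take \<open>c = -x\<close> and \<open>c = x\<close> on the half-line
  of \<open>x\<close>, and the rescaled \<open>c = x \<rho> / \<sigma>\<close> on the opposite one. Up to constants the three identities involve
  the same two boundary integrals, since solution and flux match at the interface; eliminating them
  gives \<open>v(x, T)\<close> by image charges plus an error function coming from the jump of the far-field values.
  The contour integrals are these image charges in Fourier space: each boundary of \<open>D\<close> can be rotated
  to the real axis, where the Gaussian is its own transform.
\<close>

section \<open>The heat kernel\<close>

text \<open>The equation holds only in the open quadrant, the boundary values are continuous for
  positive times and merely integrable near time 0, and the initial datum is attained only in L1.
  Green's identity therefore starts on a rectangle away from all critical edges, and each edge is
  reached by a limit of its own: decay at infinity, continuity at \<open>x = 0\<close>, L1
  continuity at \<open>t = 0\<close>, the approximate identity at \<open>t = T\<close>. Taking c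
  \<noteq> 0 keeps the singularity of the kernel off the boundary, so that integrable boundary
  values can be tested against it up to time \<open>T\<close>. The rescaled c is the solution of
  \<open>c / \<rho> = x / \<sigma>\<close>: with it the boundary kernels of the two sides are
  proportional at all times. On the Fourier side, the boundary of D is where the Gaussian factor has
  modulus 1, so absolute convergence on it comes from exp(i k x) alone. This is enough to integrate
  over k before y, and so it is an explicit entire function, not the transform of the datum, that is
  moved to the real axis.\<close>

definition heat_kernel :: "real \<Rightarrow> real \<Rightarrow> real \<Rightarrow> real" where
  "heat_kernel \<sigma> z t = exp (- z\<^sup>2 / (4 * \<sigma>\<^sup>2 * t)) / (\<sigma> * sqrt (4 * pi * t))"

definition heat_kernel_dx :: "real \<Rightarrow> real \<Rightarrow> real \<Rightarrow> real" where
  "heat_kernel_dx \<sigma> z t = - z / (2 * \<sigma>\<^sup>2 * t) * heat_kernel \<sigma> z t"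

definition heat_kernel_dxx :: "real \<Rightarrow> real \<Rightarrow> real \<Rightarrow> real" where
  "heat_kernel_dxx \<sigma> z t = (z\<^sup>2 / (4 * \<sigma>^4 * t\<^sup>2) - 1 / (2 * \<sigma>\<^sup>2 * t)) * heat_kernel \<sigma> z t"

lemma heat_kernel_has_dx:
  assumes "\<sigma> > 0" "t > 0"
  shows "((\<lambda>z. heat_kernel \<sigma> z t) has_real_derivative heat_kernel_dx \<sigma> z t) (at z)"
proof -
  have "((\<lambda>z. - z\<^sup>2 / (4 * \<sigma>\<^sup>2 * t)) has_real_derivative - (2 * z) / (4 * \<sigma>\<^sup>2 * t)) (at z)"
    by (rule DERIV_cdivide) (auto intro!: derivative_eq_intros)
  from DERIV_cdivide[OF DERIV_fun_exp[OF this], of "\<sigma> * sqrt (4 * pi * t)"] show ?thesis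
    unfolding heat_kernel_def heat_kernel_dx_def
    by (rule DERIV_cong) (simp add: field_simps)
qed

lemma heat_kernel_dx_has_dx:
  assumes "\<sigma> > 0" "t > 0"
  shows "((\<lambda>z. heat_kernel_dx \<sigma> z t) has_real_derivative heat_kernel_dxx \<sigma> z t) (at z)"
proof -
  have "((\<lambda>z. - z / (2 * \<sigma>\<^sup>2 * t)) has_real_derivative - 1 / (2 * \<sigma>\<^sup>2 * t)) (at z)"
    by (rule DERIV_cdivide) (auto intro!: derivative_eq_intros)
  from DERIV_mult[OF this heat_kernel_has_dx[OF assms]] show ?thesis
    unfolding heat_kernel_dx_def heat_kernel_dxx_def
    by (rule DERIV_cong) (use assms in \<open>simp add: field_simps power2_eq_square power4_eq_xxxx\<close>)
qed

text \<open>Separating the constants \<open>a\<close> and \<open>b\<close> leaves only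
  \<open>exp (- a / t) * inverse (sqrt t)\<close> to differentiate. Expressing the result by
  \<open>heat_kernel_dxx\<close> builds in the heat equation, which Green's identity needs.\<close>

lemma heat_kernel_has_dt:
  assumes "\<sigma> > 0" "t > 0"
  shows "((\<lambda>t. heat_kernel \<sigma> z t) has_real_derivative \<sigma>\<^sup>2 * heat_kernel_dxx \<sigma> z t) (at t)"
proof -
  define a where "a = z\<^sup>2 / (4 * \<sigma>\<^sup>2)"
  define b where "b = 1 / (\<sigma> * sqrt (4 * pi))"
  have eq: "heat_kernel \<sigma> z t = b * (exp (- a / t) * inverse (sqrt t))" for t
    by (simp add: heat_kernel_def a_def b_def real_sqrt_mult field_simps)
  have 1: "((\<lambda>t. - a / t) has_real_derivative a / t\<^sup>2) (at t)"
    using assms by (auto intro!: derivative_eq_intros simp: power2_eq_square)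
  have s: "sqrt t > 0" "sqrt t * sqrt t = t" using assms by auto
  have 2: "((\<lambda>t. inverse (sqrt t)) has_real_derivative - (inverse (sqrt t) / (2 * t))) (at t)"
    by (rule DERIV_cong[OF DERIV_inverse_fun[OF DERIV_real_sqrt]])
       (use assms s in \<open>auto simp: field_simps power2_eq_square\<close>)
  from DERIV_cmult[OF DERIV_mult[OF DERIV_fun_exp[OF 1] 2], of b] show ?thesis
    unfolding eq heat_kernel_dxx_def
    by (rule DERIV_cong)
       (use assms s(1) in \<open>simp add: a_def field_simps power2_eq_square power4_eq_xxxx\<close>)
qed

lemma continuous_on_heat_kernel [continuous_intros]:
  assumes "\<sigma> > 0" "continuous_on A f" "continuous_on A g" "\<And>x. x \<in> A \<Longrightarrow> g x > 0"
  shows "continuous_on A (\<lambda>x. heat_kernel \<sigma> (f x) (g x))"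
  unfolding heat_kernel_def
  using assms by (intro continuous_intros) (auto simp: less_imp_neq[THEN not_sym])

lemma continuous_on_heat_kernel_dx [continuous_intros]:
  assumes "\<sigma> > 0" "continuous_on A f" "continuous_on A g" "\<And>x. x \<in> A \<Longrightarrow> g x > 0"
  shows "continuous_on A (\<lambda>x. heat_kernel_dx \<sigma> (f x) (g x))"
  unfolding heat_kernel_dx_def
  using assms by (intro continuous_intros) (auto simp: less_imp_neq[THEN not_sym])

lemma continuous_on_heat_kernel_dxx [continuous_intros]:
  assumes "\<sigma> > 0" "continuous_on A f" "continuous_on A g" "\<And>x. x \<in> A \<Longrightarrow> g x > 0"
  shows "continuous_on A (\<lambda>x. heat_kernel_dxx \<sigma> (f x) (g x))"
  unfolding heat_kernel_dxx_def
  using assms by (intro continuous_intros) (auto simp: less_imp_neq[THEN not_sym])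

section \<open>Green's identity on a half-line\<close>

text \<open>Both sides of the interface become instances, with the far-field value subtracted to
  gain integrability and decay, and with the left side reflected. \<open>L1_cont\<close> is the
  sense in which the initial values are attained; joint continuity governs positive times.\<close>

locale half_line_flow =
  fixes \<sigma> :: real and v vx vt vxx :: "real \<Rightarrow> real \<Rightarrow> real"
  assumes \<sigma>: "\<sigma> > 0"
    and deriv_t: "\<And>x t. x > 0 \<Longrightarrow> t > 0 \<Longrightarrow> ((\<lambda>s. v x s) has_real_derivative vt x t) (at t)"
    and deriv_x: "\<And>x t. x > 0 \<Longrightarrow> t > 0 \<Longrightarrow> ((\<lambda>y. v y t) has_real_derivative vx x t) (at x)"
    and deriv_xx: "\<And>x t. x > 0 \<Longrightarrow> t > 0 \<Longrightarrow> ((\<lambda>y. vx y t) has_real_derivative vxx x t) (at x)"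
    and heat: "\<And>x t. x > 0 \<Longrightarrow> t > 0 \<Longrightarrow> vt x t = \<sigma>\<^sup>2 * vxx x t"
    and cont_vt: "continuous_on ({0<..} \<times> {0<..}) (\<lambda>(x, t). vt x t)"
    and cont_v: "continuous_on ({0..} \<times> {0<..}) (\<lambda>(x, t). v x t)"
    and cont_vx: "continuous_on ({0..} \<times> {0<..}) (\<lambda>(x, t). vx x t)"
    and int_v0: "\<And>T. T > 0 \<Longrightarrow> set_integrable lebesgue {0<..<T} (\<lambda>t. v 0 t)"
    and int_vx0: "\<And>T. T > 0 \<Longrightarrow> set_integrable lebesgue {0<..<T} (\<lambda>t. vx 0 t)"
    and int_v: "\<And>t. t \<ge> 0 \<Longrightarrow> set_integrable lebesgue {0<..} (\<lambda>x. v x t)"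
    and L1_cont: "((\<lambda>s. LINT x:{0<..}|lebesgue. \<bar>v x s - v x 0\<bar>) \<longlongrightarrow> 0) (at_right 0)"
    and decay: "\<And>a b. 0 < a \<Longrightarrow> uniform_limit {a..b} v (\<lambda>_. 0) at_top"
    and decay_x: "\<And>a b. 0 < a \<Longrightarrow> uniform_limit {a..b} vx (\<lambda>_. 0) at_top"
begin

lemma continuous_on_v [continuous_intros]:
  assumes "continuous_on A f" "continuous_on A g" "\<And>x. x \<in> A \<Longrightarrow> f x \<ge> 0" "\<And>x. x \<in> A \<Longrightarrow> g x > 0"
  shows "continuous_on A (\<lambda>x. v (f x) (g x))"
  using continuous_on_compose2[OF cont_v, of A "\<lambda>x. (f x, g x)"] assms
  by (auto intro!: continuous_intros)

lemma continuous_on_vx [continuous_intros]: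
  assumes "continuous_on A f" "continuous_on A g" "\<And>x. x \<in> A \<Longrightarrow> f x \<ge> 0" "\<And>x. x \<in> A \<Longrightarrow> g x > 0"
  shows "continuous_on A (\<lambda>x. vx (f x) (g x))"
  using continuous_on_compose2[OF cont_vx, of A "\<lambda>x. (f x, g x)"] assms
  by (auto intro!: continuous_intros)

lemma continuous_on_vt [continuous_intros]:
  assumes "continuous_on A f" "continuous_on A g" "\<And>x. x \<in> A \<Longrightarrow> f x > 0" "\<And>x. x \<in> A \<Longrightarrow> g x > 0"
  shows "continuous_on A (\<lambda>x. vt (f x) (g x))"
  using continuous_on_compose2[OF cont_vt, of A "\<lambda>x. (f x, g x)"] assms
  by (auto intro!: continuous_intros)

text \<open>The space component in Green's identity. As a function of \<open>s\<close>, the kernel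
  at time \<open>T - s\<close> solves the backward heat equation, so the \<open>s\<close>-derivative
  of its product with \<open>v\<close> is the \<open>y\<close>-derivative of this
  expression.\<close>

definition flux :: "real \<Rightarrow> real \<Rightarrow> real \<Rightarrow> real \<Rightarrow> real" where
  "flux T c y s = \<sigma>\<^sup>2 * (heat_kernel \<sigma> (y + c) (T - s) * vx y s - heat_kernel_dx \<sigma> (y + c) (T - s) * v y s)"

lemma continuous_on_flux:
  assumes "s2 < T" "0 < s1"
  shows "continuous_on ({0..} \<times> {s1..s2}) (\<lambda>(y, s). flux T c y s)"
  unfolding flux_def split_beta
  using assms \<sigma> by (intro continuous_intros) (auto simp: mem_Times_iff)

text \<open>Integrating \<open>g\<close> first in time gives the left-hand side, first in space the
  right-hand side. With \<open>0 < a\<close> the rectangle stays where the differential equation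
  holds.\<close>

lemma green_rectangle:
  assumes "0 < a" "a \<le> b" "0 < s1" "s1 \<le> s2" "s2 < T"
  shows "integral {a..b} (\<lambda>y. heat_kernel \<sigma> (y + c) (T - s2) * v y s2)
       - integral {a..b} (\<lambda>y. heat_kernel \<sigma> (y + c) (T - s1) * v y s1)
       = integral {s1..s2} (flux T c b) - integral {s1..s2} (flux T c a)"
proof -
  \<comment> \<open>This is the time derivative of kernel times \<open>v\<close>, the minus sign
    stemming from \<open>T - s\<close>; the equation for \<open>v\<close> makes it the space
    derivative of \<open>flux\<close> as well.\<close>
  define g where "g y s = heat_kernel \<sigma> (y + c) (T - s) * vt y s
      - \<sigma>\<^sup>2 * heat_kernel_dxx \<sigma> (y + c) (T - s) * v y s" for y s
  have cg: "continuous_on (cbox (a,s1) (b,s2)) (\<lambda>(y, s). g y s)"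
    unfolding g_def split_beta
    using assms \<sigma> by (intro continuous_intros) (auto simp: cbox_Pair_iff)
  have swap: "integral (cbox a b) (\<lambda>y. integral (cbox s1 s2) (g y)) =
        integral (cbox s1 s2) (\<lambda>s. integral (cbox a b) (\<lambda>y. g y s))"
    by (rule integral_swap_continuous[OF cg])
  have inner: "integral (cbox s1 s2) (g y) =
      heat_kernel \<sigma> (y + c) (T - s2) * v y s2 - heat_kernel \<sigma> (y + c) (T - s1) * v y s1"
    if "y \<in> {a..b}" for y
  proof -
    have "((\<lambda>s. heat_kernel \<sigma> (y + c) (T - s) * v y s) has_real_derivative g y s) (at s)"
      if s: "s \<in> {s1..s2}" for s
    proof -
      have "((\<lambda>s. heat_kernel \<sigma> (y + c) (T - s)) has_real_derivative
           \<sigma>\<^sup>2 * heat_kernel_dxx \<sigma> (y + c) (T - s) * (- 1)) (at s)"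
        by (rule DERIV_chain2[OF heat_kernel_has_dt[OF \<sigma>]])
           (use s assms in \<open>auto intro!: derivative_eq_intros\<close>)
      from DERIV_mult[OF this deriv_t[of y s]] show ?thesis
        using s \<open>y \<in> _\<close> assms by (simp add: g_def algebra_simps)
    qed
    then have "(g y has_integral (heat_kernel \<sigma> (y + c) (T - s2) * v y s2
        - heat_kernel \<sigma> (y + c) (T - s1) * v y s1)) {s1..s2}"
      using assms by (intro fundamental_theorem_of_calculus)
        (auto simp: has_real_derivative_iff_has_vector_derivative intro: has_vector_derivative_at_within)
    then show ?thesis by (simp add: integral_unique)
  qed
  have outer: "integral (cbox a b) (\<lambda>y. g y s) = flux T c b s - flux T c a s"
    if s: "s \<in> {s1..s2}" for s
  proof -
    have "((\<lambda>y. flux T c y s) has_real_derivative g y s) (at y)"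
      if y: "y \<in> {a..b}" for y
    proof -
      have y0: "y > 0" and s0: "s > 0" and Ts: "T - s > 0" using y s assms by auto
      have 1: "((\<lambda>y. heat_kernel \<sigma> (y + c) (T - s)) has_real_derivative heat_kernel_dx \<sigma> (y + c) (T - s) * 1) (at y)"
        by (rule DERIV_chain2[OF heat_kernel_has_dx[OF \<sigma> Ts]]) (auto intro!: derivative_eq_intros)
      have 2: "((\<lambda>y. heat_kernel_dx \<sigma> (y + c) (T - s)) has_real_derivative heat_kernel_dxx \<sigma> (y + c) (T - s) * 1) (at y)"
        by (rule DERIV_chain2[OF heat_kernel_dx_has_dx[OF \<sigma> Ts]]) (auto intro!: derivative_eq_intros)
      show ?thesis unfolding flux_def
        by (rule derivative_eq_intros 1 2 deriv_x[OF y0 s0] deriv_xx[OF y0 s0] refl)+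
           (simp add: g_def heat[OF y0 s0] algebra_simps)
    qed
    then have "((\<lambda>y. g y s) has_integral (flux T c b s - flux T c a s)) {a..b}"
      using assms by (intro fundamental_theorem_of_calculus)
        (auto simp: has_real_derivative_iff_has_vector_derivative intro: has_vector_derivative_at_within)
    then show ?thesis by (simp add: integral_unique)
  qed
  have "integral {a..b} (\<lambda>y. heat_kernel \<sigma> (y + c) (T - s2) * v y s2 - heat_kernel \<sigma> (y + c) (T - s1) * v y s1)
    = integral (cbox a b) (\<lambda>y. integral (cbox s1 s2) (g y))"
    unfolding box_real by (rule integral_cong) (use inner in simp)
  also note swap
  also have "integral (cbox s1 s2) (\<lambda>s. integral (cbox a b) (\<lambda>y. g y s))
    = integral {s1..s2} (\<lambda>s. flux T c b s - flux T c a s)"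
    unfolding box_real by (rule integral_cong) (use outer in simp)
  finally have "integral {a..b} (\<lambda>y. heat_kernel \<sigma> (y + c) (T - s2) * v y s2 - heat_kernel \<sigma> (y + c) (T - s1) * v y s1)
    = integral {s1..s2} (\<lambda>s. flux T c b s - flux T c a s)" .
  moreover have "(\<lambda>y. heat_kernel \<sigma> (y + c) (T - s) * v y s) integrable_on {a..b}" if "s \<in> {s1..s2}" for s
    using assms that \<sigma> by (intro integrable_continuous_interval continuous_intros) auto
  moreover have "flux T c y integrable_on {s1..s2}" if "y \<ge> 0" for y
    unfolding flux_def
    using assms that \<sigma> by (intro integrable_continuous_interval continuous_intros) auto
  ultimately show ?thesis
    using assms by (simp add: integral_diff)
qed

end

section \<open>Exhaustion and kernel bounds\<close>

lemma borel_imp_lebesgue_measurable: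
  "f \<in> borel_measurable borel \<Longrightarrow> f \<in> borel_measurable lebesgue"
  by (simp add: measurable_completion)

lemma set_integrable_bounded_mult:
  fixes f g :: "real \<Rightarrow> 'a :: {real_normed_algebra, banach, second_countable_topology}"
  assumes f: "set_integrable lebesgue S f" and S: "S \<in> sets borel" and g: "continuous_on S g"
    and M: "\<And>x. x \<in> S \<Longrightarrow> norm (g x) \<le> M"
  shows "set_integrable lebesgue S (\<lambda>x. g x * f x)"
proof -
  have [measurable]: "(\<lambda>x. indicator S x *\<^sub>R g x) \<in> borel_measurable lebesgue"
    by (intro borel_imp_lebesgue_measurable borel_measurable_continuous_on_indicator S g)
  have [measurable]: "(\<lambda>x. indicator S x *\<^sub>R f x) \<in> borel_measurable lebesgue"
    using f by (auto simp: set_integrable_def)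
  have eq: "indicator S x *\<^sub>R (g x * f x) = (indicator S x *\<^sub>R g x) * (indicator S x *\<^sub>R f x)" for x
    by (auto simp: indicator_def)
  have "integrable lebesgue (\<lambda>x. M * norm (indicator S x *\<^sub>R f x))"
    using f unfolding set_integrable_def by (intro integrable_mult_right integrable_norm)
  then show ?thesis
    unfolding set_integrable_def
  proof (rule Bochner_Integration.integrable_bound)
    show "AE x in lebesgue. norm (indicator S x *\<^sub>R (g x * f x)) \<le> norm (M * norm (indicator S x *\<^sub>R f x))"
    proof (intro AE_I2)
      fix x
      show "norm (indicator S x *\<^sub>R (g x * f x)) \<le> norm (M * norm (indicator S x *\<^sub>R f x))"
      proof (cases "x \<in> S")
        case True
        have "norm (g x * f x) \<le> norm (g x) * norm (f x)" by (rule norm_mult_ineq)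
        also have "\<dots> \<le> \<bar>M\<bar> * norm (f x)"
          using M[OF True] by (intro mult_right_mono) auto
        finally show ?thesis using True by (simp add: abs_mult)
      qed simp
    qed
  qed (unfold eq, measurable)
qed

text \<open>The fundamental theorem of calculus yields gauge integrals over compact intervals. This
  lemma and the next pass from them to Lebesgue integrals over open sets, whose endpoints are
  approached strictly from inside; the modulus of \<open>f\<close> dominates.\<close>

lemma integral_interval_exhaust:
  fixes f :: "real \<Rightarrow> real"
  assumes "set_integrable lebesgue {a<..<b} f" "\<And>n. a < l n" "\<And>n. r n < b"
    "l \<longlonglongrightarrow> a" "r \<longlonglongrightarrow> b"
  shows "(\<lambda>n. integral {l n..r n} f) \<longlonglongrightarrow> (LINT x:{a<..<b}|lebesgue. f x)"
proof -
  have "(\<lambda>n. LINT x:{l n..r n}|lebesgue. f x) \<longlonglongrightarrow> (LINT x:{a<..<b}|lebesgue. f x)"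
    unfolding set_lebesgue_integral_def
  proof (rule integral_dominated_convergence)
    have si: "set_integrable lebesgue {l n..r n} f" for n
      by (rule set_integrable_subset[OF assms(1)]) (use assms(2,3)[of n] in auto)
    then show "(\<lambda>x. indicator {l n..r n} x *\<^sub>R f x) \<in> borel_measurable lebesgue" for n
      by (auto simp: set_integrable_def)
    show "(\<lambda>x. indicator {a<..<b} x *\<^sub>R f x) \<in> borel_measurable lebesgue"
      "integrable lebesgue (\<lambda>x. norm (indicator {a<..<b} x *\<^sub>R f x))"
      using assms(1) by (auto simp: set_integrable_def)
    show "AE x in lebesgue. norm (indicator {l n..r n} x *\<^sub>R f x) \<le> norm (indicator {a<..<b} x *\<^sub>R f x)" for n
      using assms(2,3)[of n] by (intro AE_I2) (auto simp: indicator_def)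
    have "(\<lambda>n. indicator {l n..r n} x *\<^sub>R f x) \<longlonglongrightarrow> indicator {a<..<b} x *\<^sub>R f x" for x
    proof (cases "x \<in> {a<..<b}")
      case True
      then have "\<forall>\<^sub>F n in sequentially. l n < x" "\<forall>\<^sub>F n in sequentially. x < r n"
        using assms(4,5) by (auto intro: order_tendstoD)
      then have "\<forall>\<^sub>F n in sequentially. indicator {l n..r n} x *\<^sub>R f x = indicator {a<..<b} x *\<^sub>R f x"
        by eventually_elim (use True in \<open>auto simp: indicator_def\<close>)
      then show ?thesis by (rule tendsto_eventually)
    next
      case False
      then have eq: "indicator {l n..r n} x *\<^sub>R f x = indicator {a<..<b} x *\<^sub>R f x" for n
        using assms(2,3)[of n] by (auto simp: indicator_def)
      show ?thesis unfolding eq by (rule tendsto_const)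
    qed
    then show "AE x in lebesgue. (\<lambda>n. indicator {l n..r n} x *\<^sub>R f x) \<longlonglongrightarrow> indicator {a<..<b} x *\<^sub>R f x"
      by simp
  qed
  moreover have "(LINT x:{l n..r n}|lebesgue. f x) = integral {l n..r n} f" for n
    by (intro set_lebesgue_integral_eq_integral set_integrable_subset[OF assms(1)])
       (use assms(2,3)[of n] in auto)
  ultimately show ?thesis by simp
qed

lemma integral_halfline_exhaust:
  fixes f :: "real \<Rightarrow> 'a :: euclidean_space"
  assumes "set_integrable lebesgue {0<..} f"
    and l: "\<And>n. 0 < l n" "l \<longlonglongrightarrow> 0" and r: "filterlim r at_top sequentially"
  shows "(\<lambda>n. integral {l n..r n} f) \<longlonglongrightarrow> (LINT x:{0<..}|lebesgue. f x)"
proof -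
  have si: "set_integrable lebesgue {l n..r n} f" for n
    by (rule set_integrable_subset[OF assms(1)]) (use l(1)[of n] in auto)
  have "(\<lambda>n. LINT x:{l n..r n}|lebesgue. f x) \<longlonglongrightarrow> (LINT x:{0<..}|lebesgue. f x)"
    unfolding set_lebesgue_integral_def
  proof (rule integral_dominated_convergence)
    show "(\<lambda>x. indicator {l n..r n} x *\<^sub>R f x) \<in> borel_measurable lebesgue" for n
      using si[of n] by (auto simp: set_integrable_def)
    show "(\<lambda>x. indicator {0<..} x *\<^sub>R f x) \<in> borel_measurable lebesgue"
      "integrable lebesgue (\<lambda>x. norm (indicator {0<..} x *\<^sub>R f x))"
      using assms(1) unfolding set_integrable_def by (rule borel_measurable_integrable, rule integrable_norm)
    show "AE x in lebesgue. norm (indicator {l n..r n} x *\<^sub>R f x) \<le> norm (indicator {0<..} x *\<^sub>R f x)" for n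
      using l(1)[of n] by (intro AE_I2) (auto simp: indicator_def)
    have "(\<lambda>n. indicator {l n..r n} x *\<^sub>R f x) \<longlonglongrightarrow> indicator {0<..} x *\<^sub>R f x" for x
    proof (cases "x > 0")
      case True
      then have "\<forall>\<^sub>F n in sequentially. l n < x" "\<forall>\<^sub>F n in sequentially. x < r n"
        using l(2) r by (auto intro: order_tendstoD simp: filterlim_at_top_dense)
      then have "\<forall>\<^sub>F n in sequentially. indicator {l n..r n} x *\<^sub>R f x = indicator {0<..} x *\<^sub>R f x"
        by eventually_elim (use True in \<open>auto simp: indicator_def\<close>)
      then show ?thesis by (rule tendsto_eventually)
    next
      case False
      then have "x < l n" for n using l(1)[of n] by linarith
      then have eq: "indicator {l n..r n} x *\<^sub>R f x = indicator {0<..} x *\<^sub>R f x" for n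
        using False by (auto simp: indicator_def not_le)
      show ?thesis unfolding eq by (rule tendsto_const)
    qed
    then show "AE x in lebesgue. (\<lambda>n. indicator {l n..r n} x *\<^sub>R f x) \<longlonglongrightarrow> indicator {0<..} x *\<^sub>R f x"
      by simp
  qed
  moreover have "(LINT x:{l n..r n}|lebesgue. f x) = integral {l n..r n} f" for n
    by (intro set_lebesgue_integral_eq_integral si)
  ultimately show ?thesis by simp
qed

section \<open>Bounds on the kernel, and its limit at time 0 away from the origin\<close>

lemma heat_kernel_bound:
  assumes "\<sigma> > 0" "0 < a" "a \<le> t"
  shows "\<bar>heat_kernel \<sigma> z t\<bar> \<le> 1 / (\<sigma> * sqrt (4 * pi * a))"
proof -
  have "\<bar>heat_kernel \<sigma> z t\<bar> = exp (- z\<^sup>2 / (4 * \<sigma>\<^sup>2 * t)) / (\<sigma> * sqrt (4 * pi * t))"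
    using assms by (simp add: heat_kernel_def)
  also have "\<dots> \<le> 1 / (\<sigma> * sqrt (4 * pi * a))"
    using assms by (intro frac_le mult_left_mono) auto
  finally show ?thesis .
qed

text \<open>In the similarity variable \<open>w\<close> the factor \<open>z\<close> in front of the
  Gaussian costs only one more \<open>1 / sqrt t\<close>, because
  \<open>w * exp (- w\<^sup>2) \<le> 1\<close>. The bound is thus uniform in
  \<open>z\<close>.\<close>

lemma heat_kernel_dx_bound:
  assumes "\<sigma> > 0" "0 < a" "a \<le> t"
  shows "\<bar>heat_kernel_dx \<sigma> z t\<bar> \<le> 1 / (\<sigma> * sqrt a) * (1 / (\<sigma> * sqrt (4 * pi * a)))"
proof -
  define w where "w = \<bar>z\<bar> / (2 * \<sigma> * sqrt t)"
  have w: "w\<^sup>2 = z\<^sup>2 / (4 * \<sigma>\<^sup>2 * t)" "w \<ge> 0"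
    using assms by (simp_all add: w_def power_divide power_mult_distrib)
  \<comment> \<open>Leads to \<open>w \<le> 1 + w\<^sup>2 / 2\<close>, hence to
    \<open>w \<le> 1 + w\<^sup>2 \<le> exp (w\<^sup>2)\<close>.\<close>
  have "0 \<le> (w - 1)\<^sup>2 + 1" by simp
  then have "2 * w \<le> w\<^sup>2 + 2" by (simp add: power2_eq_square algebra_simps)
  then have "w \<le> exp (w\<^sup>2)" using exp_ge_add_one_self[of "w\<^sup>2"] w by (smt (verit) zero_le_power2)
  then have we: "w * exp (- w\<^sup>2) \<le> 1" by (simp add: exp_minus field_simps)
  have st: "sqrt t * sqrt t = t" "sqrt t > 0" using assms by auto
  have st2: "\<bar>z\<bar> / (2 * \<sigma>\<^sup>2 * t) = w / (\<sigma> * sqrt t)"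
    unfolding w_def using assms(1) st by (simp add: field_simps power2_eq_square)
  have "\<bar>heat_kernel_dx \<sigma> z t\<bar> = \<bar>z\<bar> / (2 * \<sigma>\<^sup>2 * t) * (exp (- w\<^sup>2) / (\<sigma> * sqrt (4 * pi * t)))"
    using assms by (simp add: heat_kernel_dx_def heat_kernel_def abs_mult w)
  also have "\<dots> = (w * exp (- w\<^sup>2)) / (\<sigma> * sqrt t) * (1 / (\<sigma> * sqrt (4 * pi * t)))"
    unfolding st2 by simp
  also have "\<dots> \<le> 1 / (\<sigma> * sqrt a) * (1 / (\<sigma> * sqrt (4 * pi * a)))"
    using assms we w(2) by (intro mult_mono frac_le mult_left_mono) auto
  finally show ?thesis .
qed

text \<open>At \<open>t = 0\<close> both functions take the junk value \<open>0\<close> of a division by zero, which is the right limit.\<close>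

lemma continuous_on_heat_kernel_time:
  assumes "\<sigma> > 0" "c \<noteq> 0"
  shows "continuous_on {0..} (heat_kernel \<sigma> c)"
  unfolding continuous_on_eq_continuous_within
proof
  fix t :: real assume "t \<in> {0..}"
  show "continuous (at t within {0..}) (heat_kernel \<sigma> c)"
  proof (cases "t = 0")
    case True
    have "c\<^sup>2 > 0" using assms by simp
    then have "((\<lambda>t. exp (- c\<^sup>2 / (4 * \<sigma>\<^sup>2 * t)) / (\<sigma> * sqrt (4 * pi * t))) \<longlongrightarrow> 0) (at_right 0)"
      using assms(1) by real_asymp
    then have "(heat_kernel \<sigma> c \<longlongrightarrow> 0) (at_right 0)"
      by (rule Lim_transform_eventually) (simp add: heat_kernel_def)
    then show ?thesis
      by (simp add: True continuous_within heat_kernel_def[of _ _ 0] at_within_Ici_at_right)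
  next
    case False
    then have "isCont (heat_kernel \<sigma> c) t"
      using \<open>t \<in> _\<close> DERIV_isCont[OF heat_kernel_has_dt[OF assms(1), of t c]] by auto
    then show ?thesis by (rule continuous_at_imp_continuous_at_within)
  qed
qed

lemma continuous_on_heat_kernel_dx_time:
  assumes "\<sigma> > 0" "c \<noteq> 0"
  shows "continuous_on {0..} (heat_kernel_dx \<sigma> c)"
  unfolding continuous_on_eq_continuous_within
proof
  fix t :: real assume "t \<in> {0..}"
  show "continuous (at t within {0..}) (heat_kernel_dx \<sigma> c)"
  proof (cases "t = 0")
    case True
    have "c\<^sup>2 > 0" using assms by simp
    then have "((\<lambda>t. (1 / t) * (exp (- c\<^sup>2 / (4 * \<sigma>\<^sup>2 * t)) / (\<sigma> * sqrt (4 * pi * t)))) \<longlongrightarrow> 0) (at_right 0)"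
      using assms(1) by real_asymp
    from tendsto_mult_right_zero[OF this, of "- c / (2 * \<sigma>\<^sup>2)"]
    have "(heat_kernel_dx \<sigma> c \<longlongrightarrow> 0) (at_right 0)"
      by (rule Lim_transform_eventually) (simp add: heat_kernel_dx_def heat_kernel_def)
    then show ?thesis
      by (simp add: True continuous_within heat_kernel_dx_def[of _ _ 0] at_within_Ici_at_right)
  next
    case False
    then have t: "t > 0" using \<open>t \<in> _\<close> by simp
    then have "isCont (heat_kernel \<sigma> c) t"
      using DERIV_isCont[OF heat_kernel_has_dt[OF assms(1), of t c]] by auto
    then have "isCont (heat_kernel_dx \<sigma> c) t"
      unfolding heat_kernel_dx_def using t assms by (intro continuous_intros) auto
    then show ?thesis by (rule continuous_at_imp_continuous_at_within)
  qed
qed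

lemma has_bochner_integral_gaussian: "has_bochner_integral lborel (\<lambda>x::real. exp (- x\<^sup>2)) (sqrt pi)"
  using has_bochner_integral_even_function[OF gaussian_moment_0] by simp

section \<open>The boundary representation\<close>

context half_line_flow
begin

lemma set_integrable_kernel_v:
  assumes "t > 0" "s \<ge> 0"
  shows "set_integrable lebesgue {0<..} (\<lambda>y. heat_kernel \<sigma> (y + c) t * v y s)"
  by (rule set_integrable_bounded_mult[OF int_v[OF assms(2)] _ _ heat_kernel_bound[OF \<sigma> assms(1) order_refl, folded real_norm_def]])
     (use assms \<sigma> in \<open>auto intro!: continuous_intros\<close>)

text \<open>Both kernels are bounded because \<open>T - s \<ge> T - s2 > 0\<close>, while
  \<open>v\<close> and \<open>vx\<close> tend to \<open>0\<close> uniformly in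
  \<open>s\<close>.\<close>

lemma integral_flux_at_infinity:
  assumes "0 < s1" "s1 \<le> s2" "s2 < T"
  shows "((\<lambda>y. integral {s1..s2} (flux T c y)) \<longlongrightarrow> 0) at_top"
proof (rule tendstoI)
  fix e :: real assume e: "e > 0"
  define M where "M = 1 / (\<sigma> * sqrt (4 * pi * (T - s2)))"
  define N where "N = 1 / (\<sigma> * sqrt (T - s2)) * M"
  have MN: "M > 0" "N > 0" using assms \<sigma> by (auto simp: M_def N_def)
  define K where "K = \<sigma>\<^sup>2 * (M + N) * (s2 - s1)"
  have K: "K \<ge> 0" using assms \<sigma> MN by (auto simp: K_def intro!: mult_nonneg_nonneg)
  \<comment> \<open>The summand \<open>1\<close> covers \<open>K = 0\<close>, which occurs for
    \<open>s1 = s2\<close>.\<close>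
  define d where "d = e / (K + 1)"
  have d: "d > 0" using e K by (simp add: d_def)
  have dK: "d * K < e" using e K by (simp add: d_def field_simps)
  have "\<forall>\<^sub>F y in at_top. \<forall>s\<in>{s1..s2}. dist (v y s) 0 < d"
       "\<forall>\<^sub>F y in at_top. \<forall>s\<in>{s1..s2}. dist (vx y s) 0 < d"
    using decay[OF assms(1), of s2] decay_x[OF assms(1), of s2] d by (auto simp: uniform_limit_iff)
  with eventually_ge_at_top[of 0]
  show "\<forall>\<^sub>F y in at_top. dist (integral {s1..s2} (flux T c y)) 0 < e"
  proof eventually_elim
    case (elim y)
    have "norm (integral {s1..s2} (flux T c y)) \<le> \<sigma>\<^sup>2 * (M * d + N * d) * (s2 - s1)"
    proof (rule integral_bound[OF assms(2)])
      show "continuous_on {s1..s2} (flux T c y)"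
        unfolding flux_def using assms \<sigma> elim by (intro continuous_intros) auto
      fix s assume s: "s \<in> {s1..s2}"
      have "\<bar>heat_kernel \<sigma> (y + c) (T - s) * vx y s\<bar> \<le> M * d"
        unfolding abs_mult M_def using s elim(3) assms \<sigma>
        by (intro mult_mono heat_kernel_bound) (auto simp: less_imp_le)
      moreover have "\<bar>heat_kernel_dx \<sigma> (y + c) (T - s) * v y s\<bar> \<le> N * d"
        unfolding abs_mult N_def M_def using s elim(2) assms \<sigma>
        by (intro mult_mono heat_kernel_dx_bound) (auto simp: less_imp_le)
      ultimately show "norm (flux T c y s) \<le> \<sigma>\<^sup>2 * (M * d + N * d)"
        unfolding flux_def real_norm_def abs_mult[of "\<sigma>\<^sup>2"] by (intro mult_mono) auto
    qed
    also have "\<dots> = d * K" by (simp add: K_def algebra_simps)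
    finally show ?case using dK by simp
  qed
qed

text \<open>Limit of \<open>green_rectangle\<close> over growing rectangles. The far edge vanishes
  by decay; the near edge converges to the boundary term because \<open>flux\<close> is continuous
  up to \<open>y = 0\<close>.\<close>

lemma green_slab:
  assumes "0 < s1" "s1 \<le> s2" "s2 < T"
  shows "(LINT y:{0<..}|lebesgue. heat_kernel \<sigma> (y + c) (T - s2) * v y s2)
       - (LINT y:{0<..}|lebesgue. heat_kernel \<sigma> (y + c) (T - s1) * v y s1)
       = - integral {s1..s2} (flux T c 0)"
proof (rule LIMSEQ_unique)
  let ?l = "\<lambda>n. inverse (real (Suc n))" and ?r = "\<lambda>n. real (Suc n)"
  let ?I = "\<lambda>n s. integral {?l n..?r n} (\<lambda>y. heat_kernel \<sigma> (y + c) (T - s) * v y s)"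
  have l: "?l \<longlonglongrightarrow> 0" by (rule LIMSEQ_inverse_real_of_nat)
  have r: "filterlim ?r at_top sequentially" by real_asymp
  show "(\<lambda>n. ?I n s2 - ?I n s1) \<longlonglongrightarrow>
      (LINT y:{0<..}|lebesgue. heat_kernel \<sigma> (y + c) (T - s2) * v y s2)
       - (LINT y:{0<..}|lebesgue. heat_kernel \<sigma> (y + c) (T - s1) * v y s1)"
    using assms l r by (intro tendsto_diff integral_halfline_exhaust set_integrable_kernel_v) auto
  have cont: "continuous_on {0..} (\<lambda>y. integral {s1..s2} (flux T c y))"
    using integral_continuous_on_param[of "{0..}" s1 s2 "flux T c"] continuous_on_flux[OF assms(3,1)] by simp
  have "(\<lambda>n. integral {s1..s2} (flux T c (?l n))) \<longlonglongrightarrow> integral {s1..s2} (flux T c 0)"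
    by (rule continuous_on_tendsto_compose[OF cont l]) auto
  then have "(\<lambda>n. integral {s1..s2} (flux T c (?r n)) - integral {s1..s2} (flux T c (?l n)))
      \<longlonglongrightarrow> 0 - integral {s1..s2} (flux T c 0)"
    by (intro tendsto_diff filterlim_compose[OF integral_flux_at_infinity[OF assms] r])
  moreover have "?I n s2 - ?I n s1 =
      integral {s1..s2} (flux T c (?r n)) - integral {s1..s2} (flux T c (?l n))" for n
  proof (rule green_rectangle)
    show "?l n \<le> ?r n" using order_trans[of "?l n" 1 "?r n"] by (simp add: inverse_le_1_iff)
  qed (use assms in auto)
  ultimately show "(\<lambda>n. ?I n s2 - ?I n s1) \<longlonglongrightarrow> - integral {s1..s2} (flux T c 0)"
    by simp
qed

text \<open>Decay handles large \<open>y\<close> and compactness the rest. A bound on the whole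
  half-line is needed in \<open>approximate_identity\<close>, where the rescaled argument ranges
  over all of it.\<close>

lemma bounded_v:
  assumes "0 < a"
  obtains M where "\<And>y s. y \<ge> 0 \<Longrightarrow> s \<in> {a..b} \<Longrightarrow> \<bar>v y s\<bar> \<le> M"
proof -
  obtain R where R: "\<And>y s. y \<ge> R \<Longrightarrow> s \<in> {a..b} \<Longrightarrow> \<bar>v y s\<bar> < 1"
    using decay[OF assms, of b] unfolding uniform_limit_iff eventually_at_top_linorder
    by (metis dist_0_norm dist_commute real_norm_def zero_less_one)
  have "continuous_on ({0..R} \<times> {a..b}) (\<lambda>(y, s). v y s)"
    by (rule continuous_on_subset[OF cont_v]) (use assms in auto)
  moreover have "compact ({0..R} \<times> {a..b})" by (intro compact_Times) auto
  ultimately have "bounded ((\<lambda>(y, s). v y s) ` ({0..R} \<times> {a..b}))"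
    by (intro compact_imp_bounded compact_continuous_image)
  then obtain M where M: "\<And>y s. y \<in> {0..R} \<Longrightarrow> s \<in> {a..b} \<Longrightarrow> \<bar>v y s\<bar> \<le> M"
    unfolding bounded_iff by fastforce
  show thesis
  proof
    fix y s :: real assume "y \<ge> 0" "s \<in> {a..b}"
    then show "\<bar>v y s\<bar> \<le> max M 1" using M[of y s] R[of y s] by (cases "y \<le> R") auto
  qed
qed

text \<open>The kernel time \<open>\<tau> n\<close> and the time \<open>T - \<tau> n\<close> of
  \<open>v\<close> move together, so joint continuity of \<open>v\<close> identifies the limit. The
  mass concentrates at \<open>- c\<close>, which is interior for \<open>c < 0\<close> and outside
  the half-line for \<open>c > 0\<close>; \<open>c = 0\<close> would put half of it on either
  side.\<close>

lemma approximate_identity: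
  assumes T: "T > 0" and c: "c \<noteq> 0" and \<tau>: "\<tau> \<longlonglongrightarrow> 0" "\<And>n. \<tau> n > 0" "\<And>n. \<tau> n \<le> T / 2"
  shows "(\<lambda>n. LINT y:{0<..}|lebesgue. heat_kernel \<sigma> (y + c) (\<tau> n) * v y (T - \<tau> n))
      \<longlonglongrightarrow> (if c < 0 then v (- c) T else 0)"
proof -
  obtain M where M: "\<And>y s. y \<ge> 0 \<Longrightarrow> s \<in> {T/2..T} \<Longrightarrow> \<bar>v y s\<bar> \<le> M"
    using bounded_v[of "T/2" T] T by auto
  have M0: "M \<ge> 0" using M[of 0 T] T by auto
  \<comment> \<open>The width of the kernel: under \<open>y = - c + r n * z\<close> it becomes the
    fixed density \<open>exp (- z\<^sup>2) / sqrt pi\<close>.\<close>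
  define r where "r n = 2 * \<sigma> * sqrt (\<tau> n)" for n
  have r: "r n > 0" for n using \<sigma> \<tau>(2) by (simp add: r_def)
  have r0: "r \<longlonglongrightarrow> 0"
    unfolding r_def using tendsto_mult_right_zero[OF tendsto_real_sqrt[OF \<tau>(1), simplified], of "2 * \<sigma>"] by simp
  \<comment> \<open>Extension by zero, so that the substitution takes place on the whole line and
    the dominating Gaussian does not depend on \<open>n\<close>.\<close>
  define w where "w n y = indicator {0<..} y * v y (T - \<tau> n)" for n y
  have w[measurable]: "w n \<in> borel_measurable borel" for n
    unfolding w_def
  proof -
    have "continuous_on {0<..} (\<lambda>y. v y (T - \<tau> n))"
      using T \<tau>(3)[of n] by (intro continuous_intros) auto
    from borel_measurable_continuous_on_indicator[OF _ this]
    show "(\<lambda>y. indicator {0<..} y * v y (T - \<tau> n)) \<in> borel_measurable borel" by simp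
  qed
  have hk[measurable]: "(\<lambda>y. heat_kernel \<sigma> (y + c) t) \<in> borel_measurable borel" for t
    unfolding heat_kernel_def by measurable
  have subst: "(LINT y:{0<..}|lebesgue. heat_kernel \<sigma> (y + c) (\<tau> n) * v y (T - \<tau> n))
     = (LINT z|lborel. exp (- z\<^sup>2) / sqrt pi * w n (- c + r n * z))" for n
  proof -
    have "(LINT y:{0<..}|lebesgue. heat_kernel \<sigma> (y + c) (\<tau> n) * v y (T - \<tau> n))
      = (LINT y|lebesgue. heat_kernel \<sigma> (y + c) (\<tau> n) * w n y)"
      unfolding set_lebesgue_integral_def w_def by (simp add: mult_ac)
    also have "\<dots> = (LINT y|lborel. heat_kernel \<sigma> (y + c) (\<tau> n) * w n y)"
      by (rule integral_completion) simp
    also have "\<dots> = \<bar>r n\<bar> *\<^sub>R (LINT z|lborel. heat_kernel \<sigma> (- c + r n * z + c) (\<tau> n) * w n (- c + r n * z))"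
      using r[of n] by (intro lborel_integral_real_affine) auto
    also have "\<dots> = (LINT z|lborel. r n * (heat_kernel \<sigma> (r n * z) (\<tau> n) * w n (- c + r n * z)))"
      using r[of n] by simp
    also have "r n * heat_kernel \<sigma> (r n * z) (\<tau> n) = exp (- z\<^sup>2) / sqrt pi" for z
      using \<sigma> \<tau>(2)[of n] by (simp add: r_def heat_kernel_def power_mult_distrib real_sqrt_mult)
    then have "(LINT z|lborel. r n * (heat_kernel \<sigma> (r n * z) (\<tau> n) * w n (- c + r n * z)))
      = (LINT z|lborel. exp (- z\<^sup>2) / sqrt pi * w n (- c + r n * z))"
      by (simp add: mult.assoc[symmetric])
    finally show ?thesis .
  qed
  define L where "L = (if c < 0 then v (- c) T else 0)"
  have gauss: "has_bochner_integral lborel (\<lambda>z::real. exp (- z\<^sup>2) / sqrt pi) 1"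
    using has_bochner_integral_divide_zero[OF has_bochner_integral_gaussian, of "sqrt pi"] by simp
  have "(\<lambda>n. LINT z|lborel. exp (- z\<^sup>2) / sqrt pi * w n (- c + r n * z)) \<longlonglongrightarrow>
      (LINT z|lborel. exp (- z\<^sup>2) / sqrt pi * L)"
  proof (rule integral_dominated_convergence)
    show "integrable lborel (\<lambda>z::real. exp (- z\<^sup>2) / sqrt pi * M)"
      using gauss by (intro integrable_mult_left) (auto simp: has_bochner_integral_iff)
    show "AE z in lborel. norm (exp (- z\<^sup>2) / sqrt pi * w n (- c + r n * z)) \<le> exp (- z\<^sup>2) / sqrt pi * M" for n
      using M M0 T \<tau>(2,3)[of n]
      by (intro AE_I2) (auto simp: abs_mult w_def indicator_def intro!: mult_left_mono divide_right_mono)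
    show "AE z in lborel. (\<lambda>n. exp (- z\<^sup>2) / sqrt pi * w n (- c + r n * z)) \<longlonglongrightarrow> exp (- z\<^sup>2) / sqrt pi * L"
    proof (intro AE_I2 tendsto_mult tendsto_const)
      fix z :: real
      have lim: "(\<lambda>n. - c + r n * z) \<longlonglongrightarrow> - c"
        using tendsto_add[OF tendsto_const tendsto_mult_left_zero[OF r0, of z], of "- c"] by simp
      show "(\<lambda>n. w n (- c + r n * z)) \<longlonglongrightarrow> L"
      proof (cases "c < 0")
        case True
        then have ev: "\<forall>\<^sub>F n in sequentially. - c + r n * z > 0"
          using order_tendstoD(1)[OF lim, of 0] by simp
        have "(\<lambda>n. (\<lambda>(y, s). v y s) (- c + r n * z, T - \<tau> n)) \<longlonglongrightarrow> (\<lambda>(y, s). v y s) (- c, T)"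
        proof (rule continuous_on_tendsto_compose[OF cont_v])
          have "(\<lambda>n. T - \<tau> n) \<longlonglongrightarrow> T - 0" by (intro tendsto_intros \<tau>(1))
          then show "(\<lambda>n. (- c + r n * z, T - \<tau> n)) \<longlonglongrightarrow> (- c, T)"
            by (intro tendsto_Pair lim) simp
          have "T - \<tau> n > 0" for n using \<tau>(3)[of n] T by simp
          with ev show "\<forall>\<^sub>F n in sequentially. (- c + r n * z, T - \<tau> n) \<in> {0..} \<times> {0<..}"
            by (auto elim: eventually_mono)
        qed (use True T in auto)
        then have "(\<lambda>n. v (- c + r n * z) (T - \<tau> n)) \<longlonglongrightarrow> L"
          using True by (simp add: L_def)
        then show ?thesis
          by (rule Lim_transform_eventually) (use ev in \<open>eventually_elim, simp add: w_def\<close>)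
      next
        case False
        then have "\<forall>\<^sub>F n in sequentially. - c + r n * z < 0"
          using order_tendstoD(2)[OF lim, of 0] c by simp
        then have "\<forall>\<^sub>F n in sequentially. w n (- c + r n * z) = L"
          by eventually_elim (use False in \<open>simp add: w_def L_def\<close>)
        then show ?thesis by (rule tendsto_eventually)
      qed
    qed
  qed simp_all
  also have "(LINT z|lborel. exp (- z\<^sup>2) / sqrt pi * L) = L"
    using has_bochner_integral_integral_eq[OF has_bochner_integral_mult_left[OF gauss]] by simp
  finally show ?thesis unfolding subst L_def .
qed

text \<open>The kernel and the datum both vary with \<open>n\<close>. With the datum frozen at time
  \<open>0\<close>, dominated convergence moves the kernel; replacing the datum costs at most
  \<open>M\<close> times an L1 distance, because \<open>T - \<tau> n \<ge> T / 2\<close> keeps the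
  kernel below \<open>M\<close>.\<close>

lemma initial_limit:
  assumes T: "T > 0" and \<tau>: "\<tau> \<longlonglongrightarrow> 0" "\<And>n. \<tau> n > 0" "\<And>n. \<tau> n \<le> T / 2"
  shows "(\<lambda>n. LINT y:{0<..}|lebesgue. heat_kernel \<sigma> (y + c) (T - \<tau> n) * v y (\<tau> n))
      \<longlonglongrightarrow> (LINT y:{0<..}|lebesgue. heat_kernel \<sigma> (y + c) T * v y 0)"
proof -
  define M where "M = 1 / (\<sigma> * sqrt (4 * pi * (T / 2)))"
  have M: "\<bar>heat_kernel \<sigma> z (T - \<tau> n)\<bar> \<le> M" for z n
    unfolding M_def using T \<tau>(3)[of n] by (intro heat_kernel_bound[OF \<sigma>]) auto
  have pos: "T - \<tau> n > 0" for n using T \<tau>(3)[of n] by simp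
  let ?K = "\<lambda>n y. heat_kernel \<sigma> (y + c) (T - \<tau> n)"
  have 1: "(\<lambda>n. LINT y:{0<..}|lebesgue. ?K n y * v y 0)
      \<longlonglongrightarrow> (LINT y:{0<..}|lebesgue. heat_kernel \<sigma> (y + c) T * v y 0)"
    unfolding set_lebesgue_integral_def
  proof (rule integral_dominated_convergence)
    show "(\<lambda>y. indicator {0<..} y *\<^sub>R (?K n y * v y 0)) \<in> borel_measurable lebesgue" for n
      using set_integrable_kernel_v[OF pos[of n], of 0 c] by (auto simp: set_integrable_def)
    show "(\<lambda>y. indicator {0<..} y *\<^sub>R (heat_kernel \<sigma> (y + c) T * v y 0)) \<in> borel_measurable lebesgue"
      using set_integrable_kernel_v[OF T, of 0 c] by (auto simp: set_integrable_def)
    show "integrable lebesgue (\<lambda>y. M * norm (indicator {0<..} y *\<^sub>R v y 0))"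
      using int_v[of 0] unfolding set_integrable_def by (intro integrable_mult_right integrable_norm) simp
    show "AE y in lebesgue. norm (indicator {0<..} y *\<^sub>R (?K n y * v y 0))
        \<le> M * norm (indicator {0<..} y *\<^sub>R v y 0)" for n
      by (intro AE_I2) (auto simp: indicator_def abs_mult intro!: mult_right_mono M)
    have "(\<lambda>n. T - \<tau> n) \<longlonglongrightarrow> T - 0" by (intro tendsto_intros \<tau>(1))
    then have "(\<lambda>n. ?K n y) \<longlonglongrightarrow> heat_kernel \<sigma> (y + c) T" for y
      by (intro isCont_tendsto_compose[OF DERIV_isCont[OF heat_kernel_has_dt[OF \<sigma>]]])
         (use T in auto)
    then show "AE y in lebesgue. (\<lambda>n. indicator {0<..} y *\<^sub>R (?K n y * v y 0))
        \<longlonglongrightarrow> indicator {0<..} y *\<^sub>R (heat_kernel \<sigma> (y + c) T * v y 0)"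
      by (intro AE_I2 tendsto_intros) simp
  qed
  have 2: "(\<lambda>n. (LINT y:{0<..}|lebesgue. ?K n y * v y (\<tau> n)) - (LINT y:{0<..}|lebesgue. ?K n y * v y 0))
      \<longlonglongrightarrow> 0"
  proof (rule Lim_null_comparison)
    have "filterlim \<tau> (at_right 0) sequentially"
      by (simp add: filterlim_at \<tau> less_imp_neq[OF \<tau>(2), symmetric])
    from filterlim_compose[OF L1_cont this]
    show "(\<lambda>n. M * (LINT y:{0<..}|lebesgue. \<bar>v y (\<tau> n) - v y 0\<bar>)) \<longlonglongrightarrow> 0"
      by (rule tendsto_mult_right_zero)
    show "\<forall>\<^sub>F n in sequentially. norm ((LINT y:{0<..}|lebesgue. ?K n y * v y (\<tau> n)) - (LINT y:{0<..}|lebesgue. ?K n y * v y 0))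
      \<le> M * (LINT y:{0<..}|lebesgue. \<bar>v y (\<tau> n) - v y 0\<bar>)"
    proof (intro always_eventually allI)
      fix n
      have si: "set_integrable lebesgue {0<..} (\<lambda>y. ?K n y * v y (\<tau> n))"
        "set_integrable lebesgue {0<..} (\<lambda>y. ?K n y * v y 0)"
        using \<tau>(2)[of n] by (auto intro!: set_integrable_kernel_v pos)
      have dv: "set_integrable lebesgue {0<..} (\<lambda>y. v y (\<tau> n) - v y 0)"
        using \<tau>(2)[of n] by (intro set_integral_diff int_v) auto
      have "norm ((LINT y:{0<..}|lebesgue. ?K n y * v y (\<tau> n)) - (LINT y:{0<..}|lebesgue. ?K n y * v y 0))
        = norm (LINT y:{0<..}|lebesgue. ?K n y * v y (\<tau> n) - ?K n y * v y 0)"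
        using si by simp
      also have "\<dots> \<le> (LINT y:{0<..}|lebesgue. norm (?K n y * v y (\<tau> n) - ?K n y * v y 0))"
        by (intro set_integral_norm_bound set_integral_diff si)
      also have "\<dots> \<le> (LINT y:{0<..}|lebesgue. M * \<bar>v y (\<tau> n) - v y 0\<bar>)"
      proof (rule set_integral_mono)
        show "set_integrable lebesgue {0<..} (\<lambda>y. norm (?K n y * v y (\<tau> n) - ?K n y * v y 0))"
          by (intro set_integrable_norm set_integral_diff si)
        show "set_integrable lebesgue {0<..} (\<lambda>y. M * \<bar>v y (\<tau> n) - v y 0\<bar>)"
          by (intro set_integrable_mult_right set_integrable_abs dv)
        show "norm (?K n y * v y (\<tau> n) - ?K n y * v y 0) \<le> M * \<bar>v y (\<tau> n) - v y 0\<bar>" for y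
          using M[of "y + c" n] by (simp add: abs_mult mult_right_mono flip: right_diff_distrib)
      qed
      finally show "norm ((LINT y:{0<..}|lebesgue. ?K n y * v y (\<tau> n)) - (LINT y:{0<..}|lebesgue. ?K n y * v y 0))
        \<le> M * (LINT y:{0<..}|lebesgue. \<bar>v y (\<tau> n) - v y 0\<bar>)" by simp
    qed
  qed
  from tendsto_add[OF 2 1] show ?thesis by simp
qed

text \<open>For \<open>c \<noteq> 0\<close> the kernels tend to \<open>0\<close> instead of blowing
  up as \<open>s\<close> approaches \<open>T\<close>. They are therefore continuous and bounded on
  \<open>[0, T]\<close> and preserve the integrability of the boundary values. The third claim
  serves the constant jump of the far-field values.\<close>

lemma boundary_integrable:
  assumes T: "T > 0" and c: "c \<noteq> 0"
  shows "set_integrable lebesgue {0<..<T} (\<lambda>s. heat_kernel \<sigma> c (T - s) * vx 0 s)"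
    and "set_integrable lebesgue {0<..<T} (\<lambda>s. heat_kernel_dx \<sigma> c (T - s) * v 0 s)"
    and "set_integrable lebesgue {0<..<T} (\<lambda>s. heat_kernel_dx \<sigma> c (T - s))"
proof -
  have key: "\<exists>M. \<forall>s\<in>{0..T}. norm (f (T - s)) \<le> M" if "continuous_on {0..} f" for f :: "real \<Rightarrow> real"
  proof -
    have "bounded (f ` {0..T})"
      by (intro compact_imp_bounded compact_continuous_image continuous_on_subset[OF that]) auto
    then obtain M where "\<forall>s\<in>{0..T}. norm (f s) \<le> M" by (auto simp: bounded_iff)
    then show ?thesis by (intro exI[of _ M]) auto
  qed
  have cont: "continuous_on {0..T} (\<lambda>s. f (T - s))" if "continuous_on {0..} f" for f :: "real \<Rightarrow> real"
    by (rule continuous_on_compose2[OF that]) (auto intro!: continuous_intros)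
  note K = continuous_on_heat_kernel_time[OF \<sigma> c] and Kx = continuous_on_heat_kernel_dx_time[OF \<sigma> c]
  show "set_integrable lebesgue {0<..<T} (\<lambda>s. heat_kernel \<sigma> c (T - s) * vx 0 s)"
    using key[OF K] by (auto intro!: set_integrable_bounded_mult int_vx0 T continuous_on_subset[OF cont[OF K]])
  show "set_integrable lebesgue {0<..<T} (\<lambda>s. heat_kernel_dx \<sigma> c (T - s) * v 0 s)"
    using key[OF Kx] by (auto intro!: set_integrable_bounded_mult int_v0 T continuous_on_subset[OF cont[OF Kx]])
  show "set_integrable lebesgue {0<..<T} (\<lambda>s. heat_kernel_dx \<sigma> c (T - s))"
    by (rule set_integrable_subset[OF absolutely_integrable_continuous_real[OF cont[OF Kx]]]) auto
qed

text \<open>The slab from \<open>\<tau> n\<close> to \<open>T - \<tau> n\<close> expands to the full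
  time interval: its upper end yields the point value, its lower end the initial term. For
  \<open>c > 0\<close> the result is a linear relation between the two boundary integrals and the
  initial datum.\<close>

lemma green_representation:
  assumes T: "T > 0" and c: "c \<noteq> 0"
  shows "(if c < 0 then v (- c) T else 0) =
      (LINT y:{0<..}|lebesgue. heat_kernel \<sigma> (y + c) T * v y 0)
      - \<sigma>\<^sup>2 * (LINT s:{0<..<T}|lebesgue. heat_kernel \<sigma> c (T - s) * vx 0 s)
      + \<sigma>\<^sup>2 * (LINT s:{0<..<T}|lebesgue. heat_kernel_dx \<sigma> c (T - s) * v 0 s)"
proof -
  \<comment> \<open>The shift by \<open>2\<close> ensures \<open>\<tau> n \<le> T / 2\<close>, so
    that the slab is never reversed.\<close>
  define \<tau> where "\<tau> n = T / real (n + 2)" for n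
  have \<tau>: "\<tau> \<longlonglongrightarrow> 0" "\<And>n. \<tau> n > 0" "\<And>n. \<tau> n \<le> T / 2"
  proof -
    show "\<tau> \<longlonglongrightarrow> 0" unfolding \<tau>_def by real_asymp
    show "\<tau> n > 0" for n using T by (simp add: \<tau>_def)
    show "\<tau> n \<le> T / 2" for n unfolding \<tau>_def using T by (intro divide_left_mono) auto
  qed
  have fl: "set_integrable lebesgue {0<..<T} (flux T c 0)"
    unfolding flux_def using boundary_integrable[OF assms] by (auto intro!: set_integrable_mult_right)
  have "(if c < 0 then v (- c) T else 0) - (LINT y:{0<..}|lebesgue. heat_kernel \<sigma> (y + c) T * v y 0)
      = - (LINT s:{0<..<T}|lebesgue. flux T c 0 s)"
  proof (rule LIMSEQ_unique)
    show "(\<lambda>n. (LINT y:{0<..}|lebesgue. heat_kernel \<sigma> (y + c) (\<tau> n) * v y (T - \<tau> n))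
         - (LINT y:{0<..}|lebesgue. heat_kernel \<sigma> (y + c) (T - \<tau> n) * v y (\<tau> n)))
       \<longlonglongrightarrow> (if c < 0 then v (- c) T else 0) - (LINT y:{0<..}|lebesgue. heat_kernel \<sigma> (y + c) T * v y 0)"
      by (intro tendsto_diff approximate_identity initial_limit assms \<tau>)
    have "(\<lambda>n. T - \<tau> n) \<longlonglongrightarrow> T - 0" by (intro tendsto_intros \<tau>(1))
    then have lim: "(\<lambda>n. - integral {\<tau> n..T - \<tau> n} (flux T c 0)) \<longlonglongrightarrow> - (LINT s:{0<..<T}|lebesgue. flux T c 0 s)"
      using \<tau> by (intro tendsto_minus integral_interval_exhaust fl) auto
    have eq: "(LINT y:{0<..}|lebesgue. heat_kernel \<sigma> (y + c) (\<tau> n) * v y (T - \<tau> n))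
         - (LINT y:{0<..}|lebesgue. heat_kernel \<sigma> (y + c) (T - \<tau> n) * v y (\<tau> n))
         = - integral {\<tau> n..T - \<tau> n} (flux T c 0)" for n
      using green_slab[of "\<tau> n" "T - \<tau> n" T c] \<tau>(2,3)[of n] by simp
    show "(\<lambda>n. (LINT y:{0<..}|lebesgue. heat_kernel \<sigma> (y + c) (\<tau> n) * v y (T - \<tau> n))
         - (LINT y:{0<..}|lebesgue. heat_kernel \<sigma> (y + c) (T - \<tau> n) * v y (\<tau> n)))
       \<longlonglongrightarrow> - (LINT s:{0<..<T}|lebesgue. flux T c 0 s)"
      unfolding eq by (rule lim)
  qed
  moreover have "(LINT s:{0<..<T}|lebesgue. flux T c 0 s) =
      \<sigma>\<^sup>2 * ((LINT s:{0<..<T}|lebesgue. heat_kernel \<sigma> c (T - s) * vx 0 s)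
      - (LINT s:{0<..<T}|lebesgue. heat_kernel_dx \<sigma> c (T - s) * v 0 s))"
    unfolding flux_def using boundary_integrable[OF assms] by simp
  ultimately show ?thesis by (simp add: algebra_simps)
qed

end

section \<open>Eliminating the boundary values\<close>

lemma erf_has_derivative: "(erf has_real_derivative 2 / sqrt pi * exp (- z\<^sup>2)) (at z)"
proof -
  \<comment> \<open>The fundamental theorem is applied on \<open>{-b..b}\<close>, of which
    \<open>z\<close> is an interior point, so the one-sided derivative is a full one.\<close>
  define b where "b = \<bar>z\<bar> + 1"
  have z: "z \<in> {-b<..<b}" by (auto simp: b_def)
  have "((\<lambda>u. LBINT y=ereal 0..ereal u. exp (- y\<^sup>2)) has_vector_derivative exp (- z\<^sup>2)) (at z within {-b..b})"
    by (rule interval_integral_FTC2) (use z in \<open>auto intro!: continuous_intros\<close>)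
  then have "((\<lambda>u. LBINT y=ereal 0..ereal u. exp (- y\<^sup>2)) has_vector_derivative exp (- z\<^sup>2)) (at z)"
    using z by (auto simp: at_within_Icc_at)
  then have "((\<lambda>u. LBINT y=0..ereal u. exp (- y\<^sup>2)) has_real_derivative exp (- z\<^sup>2)) (at z)"
    by (simp add: has_real_derivative_iff_has_vector_derivative zero_ereal_def)
  from DERIV_cmult[OF this, of "2 / sqrt pi"] show ?thesis
    unfolding erf_def by simp
qed

lemma erf_minus: "erf (- z) = - erf z"
proof -
  have "((\<lambda>z. erf z + erf (- z)) has_real_derivative 0) (at z)" for z
  proof -
    have "((\<lambda>z. erf (- z)) has_real_derivative (2 / sqrt pi * exp (- (- z)\<^sup>2)) * (- 1)) (at z)"
      by (rule DERIV_chain2[OF erf_has_derivative]) (auto intro!: derivative_eq_intros)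
    from DERIV_add[OF erf_has_derivative this] show ?thesis by simp
  qed
  then have "erf z + erf (- z) = erf 0 + erf (- 0)" by (intro DERIV_isconst_all) auto
  moreover have "erf 0 = 0" by (simp add: erf_def flip: zero_ereal_def)
  ultimately show ?thesis by simp
qed

lemma erf_at_top: "(erf \<longlongrightarrow> 1) at_top"
proof -
  have g: "integrable lborel (\<lambda>x::real. indicator {0..} x *\<^sub>R exp (- x\<^sup>2))"
    "(LBINT x. indicator {0..} x *\<^sub>R exp (- x\<^sup>2)) = sqrt pi / 2"
    using gaussian_moment_0 by (auto simp: has_bochner_integral_iff)
  have "((\<lambda>y. LBINT x. indicator {..y} x *\<^sub>R (indicator {0..} x *\<^sub>R exp (- x\<^sup>2))) \<longlongrightarrow> sqrt pi / 2) at_top"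
    unfolding g(2)[symmetric] by (rule tendsto_integral_at_top[OF _ g(1)]) simp
  from tendsto_mult_left[OF this, of "2 / sqrt pi"]
  have "((\<lambda>y. 2 / sqrt pi * (LBINT x. indicator {..y} x *\<^sub>R (indicator {0..} x *\<^sub>R exp (- x\<^sup>2)))) \<longlongrightarrow> 1) at_top"
    by simp
  then show ?thesis
  proof (rule Lim_transform_eventually)
    show "\<forall>\<^sub>F y in at_top. 2 / sqrt pi * (LBINT x. indicator {..y} x *\<^sub>R (indicator {0..} x *\<^sub>R exp (- x\<^sup>2))) = erf y"
      using eventually_ge_at_top[of 0]
    proof eventually_elim
      case (elim y)
      have "(LBINT x=ereal 0..ereal y. exp (- x\<^sup>2)) = (LBINT x:{0..y}. exp (- x\<^sup>2))"
        using elim by (rule interval_integral_Icc)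
      also have "\<dots> = (LBINT x. indicator {..y} x *\<^sub>R (indicator {0..} x *\<^sub>R exp (- x\<^sup>2)))"
        unfolding set_lebesgue_integral_def by (rule Bochner_Integration.integral_cong) (auto simp: indicator_def)
      finally show ?case by (simp add: erf_def zero_ereal_def)
    qed
  qed
qed

text \<open>The time derivative of \<open>erf (x / (2 * \<sigma> * sqrt t))\<close> is
  \<open>2 * \<sigma>\<^sup>2 * heat_kernel_dx \<sigma> x t\<close>, up to sign a first-passage
  density. At \<open>s = T\<close> the argument of \<open>erf\<close> is infinite, which contributes
  the \<open>1\<close>. This is the response to a constant boundary value, and the origin of
  \<open>erf\<close> in the theorem.\<close>

lemma integral_heat_kernel_dx_time:
  assumes \<sigma>: "\<sigma> > 0" and x: "x > 0" and T: "T > 0"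
    and int: "set_integrable lebesgue {0<..<T} (\<lambda>s. heat_kernel_dx \<sigma> x (T - s))"
  shows "\<sigma>\<^sup>2 * (LINT s:{0<..<T}|lebesgue. heat_kernel_dx \<sigma> x (T - s)) = - (1 - erf (x / (2 * sqrt (\<sigma>\<^sup>2 * T)))) / 2"
proof -
  define a where "a = x / (2 * \<sigma>)"
  have a: "a > 0" using x \<sigma> by (simp add: a_def)
  define F where "F s = erf (a / sqrt (T - s))" for s
  have F': "(F has_real_derivative - (2 * \<sigma>\<^sup>2 * heat_kernel_dx \<sigma> x (T - s))) (at s)" if "s < T" for s
  proof -
    define t where "t = T - s"
    have t: "t > 0" using that by (simp add: t_def)
    have st: "sqrt t > 0" "sqrt t * sqrt t = t" using t by auto
    have 1: "((\<lambda>t. a / sqrt t) has_real_derivative - (a / 2 / (t * sqrt t))) (at t)"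
      using t st \<sigma> by (auto intro!: derivative_eq_intros simp: field_simps power2_eq_square)
    have sq: "(a / sqrt t)\<^sup>2 = x\<^sup>2 / (4 * \<sigma>\<^sup>2 * t)"
      using t by (simp add: a_def power_divide power_mult_distrib)
    have 2: "((\<lambda>t. erf (a / sqrt t)) has_real_derivative 2 * \<sigma>\<^sup>2 * heat_kernel_dx \<sigma> x t) (at t)"
      by (rule DERIV_cong[OF DERIV_chain2[OF erf_has_derivative 1]])
         (use t \<sigma> in \<open>simp add: sq a_def heat_kernel_dx_def heat_kernel_def real_sqrt_mult field_simps power2_eq_square\<close>)
    show ?thesis unfolding F_def
      by (rule DERIV_cong[OF DERIV_chain2[where g = "\<lambda>s. T - s"
            and f = "\<lambda>t. erf (a / sqrt t)", OF 2[unfolded t_def]]]) (auto intro!: derivative_eq_intros)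
  qed
  define \<tau> where "\<tau> n = T / real (n + 2)" for n
  have \<tau>: "\<tau> \<longlonglongrightarrow> 0" "\<And>n. \<tau> n > 0" "\<And>n. \<tau> n \<le> T / 2"
  proof -
    show "\<tau> \<longlonglongrightarrow> 0" unfolding \<tau>_def by real_asymp
    show "\<tau> n > 0" for n using T by (simp add: \<tau>_def)
    show "\<tau> n \<le> T / 2" for n unfolding \<tau>_def using T by (intro divide_left_mono) auto
  qed
  have T\<tau>: "(\<lambda>n. T - \<tau> n) \<longlonglongrightarrow> T"
    using tendsto_diff[OF tendsto_const \<tau>(1), of T] by simp
  have "2 * \<sigma>\<^sup>2 * (LINT s:{0<..<T}|lebesgue. heat_kernel_dx \<sigma> x (T - s)) = F 0 - 1"
  proof (rule LIMSEQ_unique)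
    show "(\<lambda>n. 2 * \<sigma>\<^sup>2 * integral {\<tau> n..T - \<tau> n} (\<lambda>s. heat_kernel_dx \<sigma> x (T - s)))
      \<longlonglongrightarrow> 2 * \<sigma>\<^sup>2 * (LINT s:{0<..<T}|lebesgue. heat_kernel_dx \<sigma> x (T - s))"
      by (intro tendsto_mult_left integral_interval_exhaust int \<tau> T\<tau>) (use \<tau> in auto)
    have eq: "2 * \<sigma>\<^sup>2 * integral {\<tau> n..T - \<tau> n} (\<lambda>s. heat_kernel_dx \<sigma> x (T - s)) = F (\<tau> n) - F (T - \<tau> n)" for n
    proof -
      have "((\<lambda>s. - (2 * \<sigma>\<^sup>2 * heat_kernel_dx \<sigma> x (T - s))) has_integral (F (T - \<tau> n) - F (\<tau> n))) {\<tau> n..T - \<tau> n}"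
      proof (rule fundamental_theorem_of_calculus)
        show "\<tau> n \<le> T - \<tau> n" using \<tau>(3)[of n] by simp
        fix s assume "s \<in> {\<tau> n..T - \<tau> n}"
        then have "s < T" using \<tau>(2)[of n] by auto
        from F'[OF this]
        show "(F has_vector_derivative - (2 * \<sigma>\<^sup>2 * heat_kernel_dx \<sigma> x (T - s))) (at s within {\<tau> n..T - \<tau> n})"
          by (auto simp: has_real_derivative_iff_has_vector_derivative intro: has_vector_derivative_at_within)
      qed
      from integral_unique[OF this] show ?thesis by simp
    qed
    have "(\<lambda>n. F (T - \<tau> n)) \<longlonglongrightarrow> 1"
      unfolding F_def
    proof (rule filterlim_compose[OF erf_at_top])
      show "filterlim (\<lambda>n. a / sqrt (T - (T - \<tau> n))) at_top sequentially"
        unfolding \<tau>_def using T a by simp real_asymp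
    qed
    moreover have "(\<lambda>n. F (\<tau> n)) \<longlonglongrightarrow> F 0"
      by (rule isCont_tendsto_compose[OF DERIV_isCont[OF F'[OF T]] \<tau>(1)])
    ultimately show "(\<lambda>n. 2 * \<sigma>\<^sup>2 * integral {\<tau> n..T - \<tau> n} (\<lambda>s. heat_kernel_dx \<sigma> x (T - s))) \<longlonglongrightarrow> F 0 - 1"
      unfolding eq by (auto intro!: tendsto_eq_intros)
  qed
  moreover have "F 0 = erf (x / (2 * sqrt (\<sigma>\<^sup>2 * T)))"
    using \<sigma> by (simp add: F_def a_def real_sqrt_mult mult.assoc)
  ultimately show ?thesis by simp
qed

text \<open>The exponent depends only on \<open>z / \<rho>\<close>, so the kernels of the two media
  differ by their prefactors. Differentiation brings in a second factor
  \<open>\<sigma> / \<rho>\<close>, and the weight \<open>\<rho>\<^sup>2\<close> absorbs both; only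
  the undifferentiated kernel keeps a ratio.\<close>

lemma heat_kernel_scale:
  assumes "\<sigma> > 0" "\<rho> > 0" "t > 0"
  shows "heat_kernel \<rho> z t = \<sigma> / \<rho> * heat_kernel \<sigma> (z * \<sigma> / \<rho>) t"
    and "\<rho>\<^sup>2 * heat_kernel_dx \<rho> z t = \<sigma>\<^sup>2 * heat_kernel_dx \<sigma> (z * \<sigma> / \<rho>) t"
proof -
  show 1: "heat_kernel \<rho> z t = \<sigma> / \<rho> * heat_kernel \<sigma> (z * \<sigma> / \<rho>) t"
    using assms by (simp add: heat_kernel_def power_divide power_mult_distrib)
  show "\<rho>\<^sup>2 * heat_kernel_dx \<rho> z t = \<sigma>\<^sup>2 * heat_kernel_dx \<sigma> (z * \<sigma> / \<rho>) t"
    unfolding heat_kernel_dx_def 1 using assms by (simp add: field_simps power2_eq_square)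
qed

lemma heat_kernel_minus [simp]:
  "heat_kernel \<sigma> (- z) t = heat_kernel \<sigma> z t" "heat_kernel_dx \<sigma> (- z) t = - heat_kernel_dx \<sigma> z t"
  by (simp_all add: heat_kernel_def heat_kernel_dx_def)

text \<open>Three linear equations determine \<open>v x T\<close> and the two boundary integrals
  \<open>n\<close> and \<open>d\<close>. The ratio \<open>\<sigma> / \<rho>\<close>, attached to
  \<open>n\<close> but not to \<open>d\<close> in the third one, produces the reflection coefficient
  \<open>(\<sigma> - \<rho>) / (\<sigma> + \<rho>)\<close> and the transmission coefficient
  \<open>2 * \<sigma> / (\<sigma> + \<rho>)\<close>. The minus sign in \<open>flux\<close> is due to
  the reflected orientation of one side.\<close>

lemma interface_representation:
  assumes A: "half_line_flow \<sigma> v vx vt vxx" and B: "half_line_flow \<rho> w wx wt wxx"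
    and jump: "\<And>t. t > 0 \<Longrightarrow> w 0 t = v 0 t + \<gamma>"
    and flux: "\<And>t. t > 0 \<Longrightarrow> \<rho>\<^sup>2 * wx 0 t = - (\<sigma>\<^sup>2 * vx 0 t)"
    and x: "x > 0" and T: "T > 0"
  shows "v x T = - (\<rho> * \<gamma> / (\<sigma> + \<rho>)) * (1 - erf (x / (2 * sqrt (\<sigma>\<^sup>2 * T))))
      + (LINT y:{0<..}|lebesgue. heat_kernel \<sigma> (y - x) T * v y 0)
      + (\<sigma> - \<rho>) / (\<sigma> + \<rho>) * (LINT y:{0<..}|lebesgue. heat_kernel \<sigma> (y + x) T * v y 0)
      + 2 * \<sigma> / (\<sigma> + \<rho>) * (LINT y:{0<..}|lebesgue. heat_kernel \<sigma> (\<sigma> / \<rho> * y + x) T * w y 0)"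
proof -
  interpret A: half_line_flow \<sigma> v vx vt vxx by (rule A)
  interpret B: half_line_flow \<rho> w wx wt wxx by (rule B)
  note pos = A.\<sigma> B.\<sigma>
  \<comment> \<open>Chosen such that \<open>c / \<rho> = x / \<sigma>\<close>:
    \<open>heat_kernel_scale\<close> then maps the boundary kernels of \<open>w\<close> to those of
    \<open>v\<close> at \<open>x\<close>.\<close>
  define c where "c = x * \<rho> / \<sigma>"
  have c: "c > 0" "c * \<sigma> / \<rho> = x" using x pos by (auto simp: c_def)
  define n where "n = \<sigma>\<^sup>2 * (LINT s:{0<..<T}|lebesgue. heat_kernel \<sigma> x (T - s) * vx 0 s)"
  define d where "d = \<sigma>\<^sup>2 * (LINT s:{0<..<T}|lebesgue. heat_kernel_dx \<sigma> x (T - s) * v 0 s)"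
  define Im where "Im = (LINT y:{0<..}|lebesgue. heat_kernel \<sigma> (y - x) T * v y 0)"
  define Ip where "Ip = (LINT y:{0<..}|lebesgue. heat_kernel \<sigma> (y + x) T * v y 0)"
  define Ib where "Ib = (LINT y:{0<..}|lebesgue. heat_kernel \<sigma> (\<sigma> / \<rho> * y + x) T * w y 0)"
  define E where "E = 1 - erf (x / (2 * sqrt (\<sigma>\<^sup>2 * T)))"
  have E: "\<sigma>\<^sup>2 * (LINT s:{0<..<T}|lebesgue. heat_kernel_dx \<sigma> x (T - s)) = - E / 2"
    unfolding E_def using pos x T A.boundary_integrable(3)[of T x] by (intro integral_heat_kernel_dx_time) auto
  \<comment> \<open>The kernel is even and its derivative odd in space, so passing from
    \<open>x\<close> to \<open>- x\<close> changes the sign of \<open>d\<close> but not of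
    \<open>n\<close>.\<close>
  have 1: "v x T = Im - n - d"
    using A.green_representation[of T "- x"] x T by (simp add: Im_def n_def d_def set_lebesgue_integral_def)
  have 2: "0 = Ip - n + d"
    using A.green_representation[of T x] x T by (simp add: Ip_def n_def d_def)
  \<comment> \<open>The boundary integrals of \<open>w\<close> in terms of those of
    \<open>v\<close>: the flux condition turns the first into a multiple of \<open>n\<close>, and
    the jump adds to \<open>d\<close> the response to the constant \<open>\<gamma>\<close>.\<close>
  have 3: "0 = \<sigma> / \<rho> * Ib + \<sigma> / \<rho> * n + (d - \<gamma> * E / 2)"
  proof -
    have "(LINT y:{0<..}|lebesgue. heat_kernel \<rho> (y + c) T * w y 0)
        = (LINT y:{0<..}|lebesgue. \<sigma> / \<rho> * (heat_kernel \<sigma> (\<sigma> / \<rho> * y + x) T * w y 0))"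
    proof (intro set_lebesgue_integral_cong allI impI)
      fix y
      have "(y + c) * \<sigma> / \<rho> = \<sigma> / \<rho> * y + x" using c(2) by (simp add: algebra_simps add_divide_distrib)
      then show "heat_kernel \<rho> (y + c) T * w y 0 = \<sigma> / \<rho> * (heat_kernel \<sigma> (\<sigma> / \<rho> * y + x) T * w y 0)"
        by (simp add: heat_kernel_scale(1)[OF pos T])
    qed simp
    also have "\<dots> = \<sigma> / \<rho> * Ib" unfolding Ib_def by simp
    finally have i: "(LINT y:{0<..}|lebesgue. heat_kernel \<rho> (y + c) T * w y 0) = \<sigma> / \<rho> * Ib" .
    have "\<rho>\<^sup>2 * (LINT s:{0<..<T}|lebesgue. heat_kernel \<rho> c (T - s) * wx 0 s)
        = (LINT s:{0<..<T}|lebesgue. \<rho>\<^sup>2 * (heat_kernel \<rho> c (T - s) * wx 0 s))" by simp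
    also have "\<dots> = (LINT s:{0<..<T}|lebesgue. - (\<sigma> / \<rho> * \<sigma>\<^sup>2) * (heat_kernel \<sigma> x (T - s) * vx 0 s))"
    proof (intro set_lebesgue_integral_cong allI impI)
      fix s assume "s \<in> {0<..<T}"
      then have s: "s > 0" "T - s > 0" by auto
      have "\<rho>\<^sup>2 * (heat_kernel \<rho> c (T - s) * wx 0 s) = heat_kernel \<rho> c (T - s) * (\<rho>\<^sup>2 * wx 0 s)" by simp
      then show "\<rho>\<^sup>2 * (heat_kernel \<rho> c (T - s) * wx 0 s) = - (\<sigma> / \<rho> * \<sigma>\<^sup>2) * (heat_kernel \<sigma> x (T - s) * vx 0 s)"
        unfolding flux[OF s(1)] heat_kernel_scale(1)[OF pos s(2)] c(2) by simp
    qed simp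
    also have "\<dots> = - (\<sigma> / \<rho>) * n" by (subst set_integral_mult_right) (simp add: n_def)
    finally have ii: "\<rho>\<^sup>2 * (LINT s:{0<..<T}|lebesgue. heat_kernel \<rho> c (T - s) * wx 0 s) = - (\<sigma> / \<rho>) * n" .
    have "\<rho>\<^sup>2 * (LINT s:{0<..<T}|lebesgue. heat_kernel_dx \<rho> c (T - s) * w 0 s)
        = (LINT s:{0<..<T}|lebesgue. \<rho>\<^sup>2 * (heat_kernel_dx \<rho> c (T - s) * w 0 s))" by simp
    also have "\<dots> = (LINT s:{0<..<T}|lebesgue. \<sigma>\<^sup>2 * (heat_kernel_dx \<sigma> x (T - s) * v 0 s)
        + \<gamma> * (\<sigma>\<^sup>2 * heat_kernel_dx \<sigma> x (T - s)))"
    proof (intro set_lebesgue_integral_cong allI impI)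
      fix s assume "s \<in> {0<..<T}"
      then have s: "s > 0" "T - s > 0" by auto
      have "\<rho>\<^sup>2 * (heat_kernel_dx \<rho> c (T - s) * w 0 s) = (\<rho>\<^sup>2 * heat_kernel_dx \<rho> c (T - s)) * w 0 s" by simp
      then show "\<rho>\<^sup>2 * (heat_kernel_dx \<rho> c (T - s) * w 0 s) = \<sigma>\<^sup>2 * (heat_kernel_dx \<sigma> x (T - s) * v 0 s)
        + \<gamma> * (\<sigma>\<^sup>2 * heat_kernel_dx \<sigma> x (T - s))"
        unfolding jump[OF s(1)] heat_kernel_scale(2)[OF pos s(2)] c(2) by (simp add: algebra_simps)
    qed simp
    also have "\<dots> = d + \<gamma> * (\<sigma>\<^sup>2 * (LINT s:{0<..<T}|lebesgue. heat_kernel_dx \<sigma> x (T - s)))"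
      unfolding d_def using A.boundary_integrable(2,3)[OF T, of x] x by (subst set_integral_add) auto
    also have "\<dots> = d - \<gamma> * E / 2" unfolding E by simp
    finally have iii: "\<rho>\<^sup>2 * (LINT s:{0<..<T}|lebesgue. heat_kernel_dx \<rho> c (T - s) * w 0 s) = d - \<gamma> * E / 2" .
    show ?thesis
      using B.green_representation[of T c] c(1) T unfolding i ii iii by simp
  qed
  have "d = n - Ip" using 2 by simp
  with 3 have "(\<sigma> + \<rho>) * n = \<rho> * (Ip + \<gamma> * E / 2) - \<sigma> * Ib" using pos by (simp add: field_simps)
  then have n: "n = (\<rho> * (Ip + \<gamma> * E / 2) - \<sigma> * Ib) / (\<sigma> + \<rho>)" using pos by (simp add: field_simps)
  have "v x T = Im + Ip - 2 * n" using 1 2 by simp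
  also have "\<dots> = - (\<rho> * \<gamma> / (\<sigma> + \<rho>)) * E + Im + (\<sigma> - \<rho>) / (\<sigma> + \<rho>) * Ip + 2 * \<sigma> / (\<sigma> + \<rho>) * Ib"
  proof -
    have "\<sigma> + \<rho> \<noteq> 0" using pos by simp
    then show ?thesis unfolding n by (simp add: divide_simps) (simp add: algebra_simps)
  qed
  finally show ?thesis by (simp add: Im_def Ip_def Ib_def E_def)
qed

section \<open>From the solution concept to flows on the positive half-line\<close>

lemma lebesgue_set_integral_reflect:
  fixes f :: "real \<Rightarrow> 'a :: euclidean_space"
  shows "(LINT x:{..<0}|lebesgue. f x) = (LINT x:{0<..}|lebesgue. f (- x))"
    and "set_integrable lebesgue {..<0} f \<longleftrightarrow> set_integrable lebesgue {0<..} (\<lambda>x. f (- x))"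
proof -
  have ind: "indicator {..<0} (- x) = (indicator {0<..} x :: real)" for x :: real
    by (auto simp: indicator_def)
  show "(LINT x:{..<0}|lebesgue. f x) = (LINT x:{0<..}|lebesgue. f (- x))"
    unfolding set_lebesgue_integral_def
    by (subst lebesgue_integral_real_affine[of "-1" _ 0]) (simp_all add: ind)
  show "set_integrable lebesgue {..<0} f \<longleftrightarrow> set_integrable lebesgue {0<..} (\<lambda>x. f (- x))"
    unfolding set_integrable_def
    by (subst lebesgue_integrable_real_affine_iff[of "-1" _ 0, symmetric]) (simp_all add: ind)
qed

lemma half_line_heat_solution_pde:
  assumes sol: "half_line_heat_solution S F \<sigma> \<gamma> u0 u ux"
  obtains ut uxx where
    "\<And>x t. x \<in> S \<Longrightarrow> t > 0 \<Longrightarrow> ((\<lambda>s. u x s) has_real_derivative ut x t) (at t)"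
    "\<And>x t. x \<in> S \<Longrightarrow> t > 0 \<Longrightarrow> ((\<lambda>y. u y t) has_real_derivative ux x t) (at x)"
    "\<And>x t. x \<in> S \<Longrightarrow> t > 0 \<Longrightarrow> ((\<lambda>y. ux y t) has_real_derivative uxx x t) (at x)"
    "\<And>x t. x \<in> S \<Longrightarrow> t > 0 \<Longrightarrow> ut x t = \<sigma>\<^sup>2 * uxx x t"
    "continuous_on (S \<times> {0<..}) (\<lambda>(x, t). ut x t)"
  using conjunct1[OF sol[unfolded half_line_heat_solution_def]] by blast

lemma half_line_heat_solutionD:
  assumes sol: "half_line_heat_solution S F \<sigma> \<gamma> u0 u ux"
  shows "continuous_on (closure S \<times> {0<..}) (\<lambda>(x, t). u x t)"
    "continuous_on (closure S \<times> {0<..}) (\<lambda>(x, t). ux x t)"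
    "T > 0 \<Longrightarrow> (\<lambda>t. u 0 t) absolutely_integrable_on {0<..<T}"
    "T > 0 \<Longrightarrow> (\<lambda>t. ux 0 t) absolutely_integrable_on {0<..<T}"
    "x \<in> S \<Longrightarrow> u x 0 = u0 x"
    "t \<ge> 0 \<Longrightarrow> (\<lambda>x. u x t - \<gamma>) absolutely_integrable_on S"
    "t \<ge> 0 \<Longrightarrow> ((\<lambda>s. LINT x:S|lebesgue. \<bar>(u x s - \<gamma>) - (u x t - \<gamma>)\<bar>) \<longlongrightarrow> 0) (at t within {0..})"
    "compact K \<Longrightarrow> K \<subseteq> {0<..} \<Longrightarrow> uniform_limit K (\<lambda>x t. u x t - \<gamma>) (\<lambda>_. 0) F"
    "compact K \<Longrightarrow> K \<subseteq> {0<..} \<Longrightarrow> uniform_limit K (\<lambda>x t. ux x t) (\<lambda>_. 0) F"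
  by (insert sol[unfolded half_line_heat_solution_def], elim conjE, simp only: simp_thms)+

lemma set_integrable_boundary_shift:
  fixes f :: "real \<Rightarrow> real"
  assumes "f absolutely_integrable_on {0<..<T}"
  shows "set_integrable lebesgue {0<..<T} (\<lambda>t. f t - c)"
proof (rule set_integral_diff(1)[OF assms])
  have "(\<lambda>t. c) absolutely_integrable_on {0..T}"
    by (rule absolutely_integrable_continuous_real) simp
  then show "set_integrable lebesgue {0<..<T} (\<lambda>t. c)"
    by (rule set_integrable_subset) auto
qed

lemma half_line_flow_right:
  assumes \<sigma>: "\<sigma> > 0" and sol: "half_line_heat_solution {0<..} at_top \<sigma> \<gamma> u0 u ux"
  obtains vt vxx where "half_line_flow \<sigma> (\<lambda>x t. u x t - \<gamma>) ux vt vxx"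
proof -
  obtain ut uxx where pde:
    "\<And>x t. x \<in> {0<..} \<Longrightarrow> t > 0 \<Longrightarrow> ((\<lambda>s. u x s) has_real_derivative ut x t) (at t)"
    "\<And>x t. x \<in> {0<..} \<Longrightarrow> t > 0 \<Longrightarrow> ((\<lambda>y. u y t) has_real_derivative ux x t) (at x)"
    "\<And>x t. x \<in> {0<..} \<Longrightarrow> t > 0 \<Longrightarrow> ((\<lambda>y. ux y t) has_real_derivative uxx x t) (at x)"
    "\<And>x t. x \<in> {0<..} \<Longrightarrow> t > 0 \<Longrightarrow> ut x t = \<sigma>\<^sup>2 * uxx x t"
    and cont: "continuous_on ({0<..} \<times> {0<..}) (\<lambda>(x, t). ut x t)"
    by (rule half_line_heat_solution_pde[OF sol]) blast
  note D = half_line_heat_solutionD[OF sol]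
  have compact: "compact {a..b}" "{a..b} \<subseteq> {0<..}" if "0 < a" for a b :: real
    using that by auto
  have "half_line_flow \<sigma> (\<lambda>x t. u x t - \<gamma>) ux ut uxx"
  proof (rule half_line_flow.intro)
    show "((\<lambda>s. u x s - \<gamma>) has_real_derivative ut x t) (at t)" if "x > 0" "t > 0" for x t
      using DERIV_diff[OF pde(1)[of x t] DERIV_const, of \<gamma>] that by simp
    show "((\<lambda>y. u y t - \<gamma>) has_real_derivative ux x t) (at x)" if "x > 0" "t > 0" for x t
      using DERIV_diff[OF pde(2)[of x t] DERIV_const, of \<gamma>] that by simp
    show "((\<lambda>y. ux y t) has_real_derivative uxx x t) (at x)" if "x > 0" "t > 0" for x t
      by (rule pde(3)) (use that in auto)
    show "ut x t = \<sigma>\<^sup>2 * uxx x t" if "x > 0" "t > 0" for x t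
      by (rule pde(4)) (use that in auto)
    show "continuous_on ({0..} \<times> {0<..}) (\<lambda>(x, t). u x t - \<gamma>)"
      using continuous_on_diff[OF D(1) continuous_on_const, of \<gamma>]
      by (simp add: split_beta' closure_greaterThan)
    show "continuous_on ({0..} \<times> {0<..}) (\<lambda>(x, t). ux x t)"
      using D(2) by (simp add: closure_greaterThan)
    show "set_integrable lebesgue {0<..<T} (\<lambda>t. u 0 t - \<gamma>)" if "T > 0" for T
      by (rule set_integrable_boundary_shift[OF D(3)[OF that]])
    show "set_integrable lebesgue {0<..<T} (\<lambda>t. ux 0 t)" if "T > 0" for T
      by (rule D(4)[OF that])
    show "set_integrable lebesgue {0<..} (\<lambda>x. u x t - \<gamma>)" if "t \<ge> 0" for t
      by (rule D(6)[OF that])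
    show "((\<lambda>s. LINT x:{0<..}|lebesgue. \<bar>(u x s - \<gamma>) - (u x 0 - \<gamma>)\<bar>) \<longlongrightarrow> 0) (at_right 0)"
      using D(7)[of 0] unfolding at_within_Ici_at_right by (simp only: order_refl)
    show "uniform_limit {a..b} (\<lambda>x t. u x t - \<gamma>) (\<lambda>_. 0) at_top" if "0 < a" for a b
      by (rule D(8)[OF compact[OF that]])
    show "uniform_limit {a..b} ux (\<lambda>_. 0) at_top" if "0 < a" for a b
      by (rule D(9)[OF compact[OF that]])
  qed (fact \<sigma> cont)+
  then show thesis by (rule that)
qed

text \<open>The heat equation is invariant under \<open>x \<mapsto> - x\<close>: the first space
  derivative changes sign, the second does not, and \<open>at_bot\<close> becomes
  \<open>at_top\<close>.\<close>

lemma half_line_flow_left: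
  assumes \<sigma>: "\<sigma> > 0" and sol: "half_line_heat_solution {..<0} at_bot \<sigma> \<gamma> u0 u ux"
  obtains vt vxx where "half_line_flow \<sigma> (\<lambda>x t. u (- x) t - \<gamma>) (\<lambda>x t. - ux (- x) t) vt vxx"
proof -
  obtain ut uxx where pde:
    "\<And>x t. x \<in> {..<0} \<Longrightarrow> t > 0 \<Longrightarrow> ((\<lambda>s. u x s) has_real_derivative ut x t) (at t)"
    "\<And>x t. x \<in> {..<0} \<Longrightarrow> t > 0 \<Longrightarrow> ((\<lambda>y. u y t) has_real_derivative ux x t) (at x)"
    "\<And>x t. x \<in> {..<0} \<Longrightarrow> t > 0 \<Longrightarrow> ((\<lambda>y. ux y t) has_real_derivative uxx x t) (at x)"
    "\<And>x t. x \<in> {..<0} \<Longrightarrow> t > 0 \<Longrightarrow> ut x t = \<sigma>\<^sup>2 * uxx x t"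
    and cont: "continuous_on ({..<0} \<times> {0<..}) (\<lambda>(x, t). ut x t)"
    by (rule half_line_heat_solution_pde[OF sol]) blast
  note D = half_line_heat_solutionD[OF sol]
  have compact: "compact {a..b}" "{a..b} \<subseteq> {0<..}" if "0 < a" for a b :: real
    using that by auto
  have d: "((\<lambda>y. f (- y)) has_real_derivative - D) (at x)"
    if "(f has_real_derivative D) (at (- x))" for f D x
    by (rule DERIV_cong[OF DERIV_chain2[where f = f and g = uminus, OF that]])
       (auto intro!: derivative_eq_intros)
  have c: "continuous_on (S \<times> {0<..}) (\<lambda>p. f (- fst p) (snd p))"
    if "continuous_on (S' \<times> {0<..}) (\<lambda>(x, t). f x t)" "\<And>x. x \<in> S \<Longrightarrow> - x \<in> S'"
    for f :: "real \<Rightarrow> real \<Rightarrow> real" and S S'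
    using continuous_on_compose2[OF that(1), of "S \<times> {0<..}" "\<lambda>p. (- fst p, snd p)"] that(2)
    by (force simp: split_beta image_subset_iff intro!: continuous_intros)
  have F: "filterlim (\<lambda>x::real. - x) at_bot at_top" by (rule filterlim_uminus_at_bot_at_top)
  have "half_line_flow \<sigma> (\<lambda>x t. u (- x) t - \<gamma>) (\<lambda>x t. - ux (- x) t) (\<lambda>x. ut (- x)) (\<lambda>x. uxx (- x))"
  proof (rule half_line_flow.intro)
    show "((\<lambda>s. u (- x) s - \<gamma>) has_real_derivative ut (- x) t) (at t)" if "x > 0" "t > 0" for x t
      using DERIV_diff[OF pde(1)[of "- x" t] DERIV_const, of \<gamma>] that by simp
    show "((\<lambda>y. u (- y) t - \<gamma>) has_real_derivative - ux (- x) t) (at x)" if "x > 0" "t > 0" for x t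
      using DERIV_diff[OF d[OF pde(2)[of "- x" t]] DERIV_const, of \<gamma>] that by simp
    show "((\<lambda>y. - ux (- y) t) has_real_derivative uxx (- x) t) (at x)" if "x > 0" "t > 0" for x t
      using DERIV_minus[OF d[OF pde(3)[of "- x" t]]] that by simp
    show "ut (- x) t = \<sigma>\<^sup>2 * uxx (- x) t" if "x > 0" "t > 0" for x t
      by (rule pde(4)) (use that in auto)
    show "continuous_on ({0<..} \<times> {0<..}) (\<lambda>(x, t). ut (- x) t)"
      using c[OF cont, of "{0<..}"] by (simp add: split_beta')
    have "continuous_on ({0..} \<times> {0<..}) (\<lambda>p. u (- fst p) (snd p))"
      by (rule c[OF D(1)]) simp
    from continuous_on_diff[OF this continuous_on_const, of \<gamma>]
    show "continuous_on ({0..} \<times> {0<..}) (\<lambda>(x, t). u (- x) t - \<gamma>)"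
      by (simp add: split_beta')
    have "continuous_on ({0..} \<times> {0<..}) (\<lambda>p. ux (- fst p) (snd p))"
      by (rule c[OF D(2)]) simp
    from continuous_on_minus[OF this]
    show "continuous_on ({0..} \<times> {0<..}) (\<lambda>(x, t). - ux (- x) t)"
      by (simp add: split_beta')
    show "set_integrable lebesgue {0<..<T} (\<lambda>t. u (- 0) t - \<gamma>)" if "T > 0" for T
      using set_integrable_boundary_shift[OF D(3)[OF that]] by simp
    show "set_integrable lebesgue {0<..<T} (\<lambda>t. - ux (- 0) t)" if "T > 0" for T
      using set_integrable_mult_right[OF D(4)[OF that], of "- 1"] by simp
    show "set_integrable lebesgue {0<..} (\<lambda>x. u (- x) t - \<gamma>)" if "t \<ge> 0" for t
      by (rule D(6)[OF that, unfolded lebesgue_set_integral_reflect])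
    show "((\<lambda>s. LINT x:{0<..}|lebesgue. \<bar>(u (- x) s - \<gamma>) - (u (- x) 0 - \<gamma>)\<bar>) \<longlongrightarrow> 0) (at_right 0)"
      using D(7)[of 0] unfolding at_within_Ici_at_right lebesgue_set_integral_reflect
      by (simp only: order_refl)
    show "uniform_limit {a..b} (\<lambda>x t. u (- x) t - \<gamma>) (\<lambda>_. 0) at_top" if "0 < a" for a b
      by (rule filterlim_compose[OF D(8)[OF compact[OF that]] F])
    show "uniform_limit {a..b} (\<lambda>x t. - ux (- x) t) (\<lambda>_. 0) at_top" if "0 < a" for a b
      using uniform_limit_uminus[OF filterlim_compose[OF D(9)[OF compact[OF that]] F]] by simp
  qed (fact \<sigma>)
  then show thesis by (rule that)
qed

section \<open>Fourier representation of the kernels\<close>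

text \<open>The initial data are only Lebesgue measurable, so the space variable in Fubini's theorem
  runs over \<open>lebesgue\<close>, which has to be sigma-finite.\<close>

lemma sigma_finite_lebesgue: "sigma_finite_measure (lebesgue :: 'a :: euclidean_space measure)"
proof
  show "\<exists>A. countable A \<and> A \<subseteq> sets lebesgue \<and> \<Union> A = space (lebesgue :: 'a measure) \<and> (\<forall>a\<in>A. emeasure lebesgue a \<noteq> \<infinity>)"
  proof (intro exI[of _ "range (\<lambda>n::nat. cball (0::'a) (real n))"] conjI ballI)
    show "\<Union> (range (\<lambda>n::nat. cball (0::'a) (real n))) = space lebesgue"
      by (auto intro: real_arch_simple)
    fix a assume "a \<in> range (\<lambda>n::nat. cball (0::'a) (real n))"
    then have "a \<in> lmeasurable" by auto
    then show "emeasure lebesgue a \<noteq> \<infinity>" by (auto simp: fmeasurable_def)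
  qed auto
qed

text \<open>The integrand is dominated by the product of \<open>h\<close> in the contour parameter
  and the modulus of \<open>w\<close> in space. The second claim allows the integrals belonging to
  two rays to be subtracted later.\<close>

lemma fubini_kernel:
  fixes g :: "real \<Rightarrow> real \<Rightarrow> complex" and w :: "real \<Rightarrow> real"
  assumes g: "continuous_on UNIV (\<lambda>(r, y). g r y)"
    and S: "S \<in> sets borel" and h: "set_integrable lborel S h"
    and bound: "\<And>r y. r \<in> S \<Longrightarrow> y > 0 \<Longrightarrow> norm (g r y) \<le> h r"
    and w: "set_integrable lebesgue {0<..} w"
  shows "(LINT r:S|lborel. LINT y:{0<..}|lebesgue. g r y * of_real (w y)) =
         (LINT y:{0<..}|lebesgue. (LINT r:S|lborel. g r y) * of_real (w y))" (is ?fubini)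
    and fubini_kernel_integrable:
      "set_integrable lebesgue {0<..} (\<lambda>y. (LINT r:S|lborel. g r y) * of_real (w y))" (is ?int)
proof -
  interpret L: sigma_finite_measure "lebesgue :: real measure" by (rule sigma_finite_lebesgue)
  interpret P: pair_sigma_finite lborel "lebesgue :: real measure" ..
  define w' where "w' = (\<lambda>y. indicator {0<..} y *\<^sub>R w y)"
  have w'[measurable]: "w' \<in> borel_measurable lebesgue" and w'i: "integrable lebesgue w'"
    using w by (auto simp: set_integrable_def w'_def simp del: real_scaleR_def)
  have S'[measurable]: "S \<in> sets borel" by (rule S)
  have g'[measurable]: "(\<lambda>p. g (fst p) (snd p)) \<in> borel_measurable (borel \<Otimes>\<^sub>M borel)"
    using borel_measurable_continuous_onI[OF g] unfolding borel_prod by (simp add: split_beta')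
  have gm: "(\<lambda>p. g (fst p) (snd p)) \<in> borel_measurable (lborel \<Otimes>\<^sub>M lebesgue)"
  proof -
    have "(\<lambda>p. (fst p, snd p)) \<in> (lborel \<Otimes>\<^sub>M lebesgue) \<rightarrow>\<^sub>M (borel \<Otimes>\<^sub>M (borel :: real measure))"
      by (intro measurable_Pair measurable_compose[OF measurable_fst] measurable_compose[OF measurable_snd]
          borel_imp_lebesgue_measurable) auto
    from measurable_compose[OF this g'] show ?thesis by simp
  qed
  define f where "f r y = indicator S r *\<^sub>R (g r y * of_real (w' y))" for r y
  have [measurable]: "(\<lambda>p. w' (snd p)) \<in> borel_measurable (lborel \<Otimes>\<^sub>M lebesgue)"
    by (rule measurable_compose[OF measurable_snd w'])
  have fm: "case_prod f \<in> borel_measurable (lborel \<Otimes>\<^sub>M lebesgue)"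
    unfolding f_def split_beta' using gm by measurable
  \<comment> \<open>The integrable majorant: a product of functions of one variable each.\<close>
  have hw: "integrable (lborel \<Otimes>\<^sub>M lebesgue) (\<lambda>p. (indicator S (fst p) *\<^sub>R h (fst p)) * w' (snd p))"
  proof (rule P.Fubini_integrable)
    have hm: "(\<lambda>r. indicator S r *\<^sub>R h r) \<in> borel_measurable lborel"
      using h by (auto simp: set_integrable_def)
    show "(\<lambda>p. (indicator S (fst p) *\<^sub>R h (fst p)) * w' (snd p)) \<in> borel_measurable (lborel \<Otimes>\<^sub>M lebesgue)"
      by (intro borel_measurable_times measurable_compose[OF measurable_fst hm]) measurable
    have "integrable lborel (\<lambda>r. norm (indicator S r *\<^sub>R h r) * (LINT y|lebesgue. norm (w' y)))"
      using h by (intro integrable_mult_left integrable_norm) (auto simp: set_integrable_def)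
    then show "integrable lborel (\<lambda>r. LINT y|lebesgue. norm ((indicator S (fst (r, y)) *\<^sub>R h (fst (r, y))) * w' (snd (r, y))))"
      by (simp add: abs_mult)
    show "AE r in lborel. integrable lebesgue (\<lambda>y. (indicator S (fst (r, y)) *\<^sub>R h (fst (r, y))) * w' (snd (r, y)))"
      using w'i by (intro AE_I2) simp
  qed
  have fi: "integrable (lborel \<Otimes>\<^sub>M lebesgue) (case_prod f)"
    using hw fm
  proof (rule Bochner_Integration.integrable_bound, intro AE_I2)
    fix p :: "real \<times> real"
    show "norm (case_prod f p) \<le> norm ((indicator S (fst p) *\<^sub>R h (fst p)) * w' (snd p))"
    proof (cases "fst p \<in> S \<and> snd p > 0")
      case True
      then have "norm (g (fst p) (snd p)) * \<bar>w' (snd p)\<bar> \<le> \<bar>h (fst p)\<bar> * \<bar>w' (snd p)\<bar>"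
        using bound[of "fst p" "snd p"] by (intro mult_right_mono) auto
      then show ?thesis using True by (simp add: f_def split_beta' norm_mult abs_mult)
    qed (auto simp: f_def w'_def split_beta' indicator_def)
  qed
  from P.Fubini_integral[OF this]
  have swap: "(LINT y|lebesgue. LINT r|lborel. f r y) = (LINT r|lborel. LINT y|lebesgue. f r y)" .
  have inner: "(LINT r|lborel. f r y) = indicator {0<..} y *\<^sub>R ((LINT r:S|lborel. g r y) * of_real (w y))" for y
  proof -
    have "(LINT r|lborel. f r y) = (LINT r|lborel. (indicator S r *\<^sub>R g r y) * of_real (w' y))"
      by (simp add: f_def)
    also have "\<dots> = (LINT r:S|lborel. g r y) * of_real (w' y)"
      unfolding set_lebesgue_integral_def by (rule integral_mult_left_zero)
    finally show ?thesis by (simp add: w'_def indicator_def)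
  qed
  have outer: "(LINT y|lebesgue. f r y) = indicator S r *\<^sub>R (LINT y:{0<..}|lebesgue. g r y * of_real (w y))" for r
  proof -
    have "(LINT y|lebesgue. f r y) = (LINT y|lebesgue. indicator S r *\<^sub>R (indicator {0<..} y *\<^sub>R (g r y * of_real (w y))))"
      by (rule Bochner_Integration.integral_cong) (auto simp: f_def w'_def indicator_def)
    then show ?thesis
      unfolding set_lebesgue_integral_def by (cases "r \<in> S") simp_all
  qed
  show ?fubini
    using swap unfolding inner outer set_lebesgue_integral_def[symmetric] by simp
  show ?int
    using P.integrable_snd[OF fi] unfolding inner set_integrable_def .
qed

text \<open>Contour integrals are taken over \<open>lborel\<close>, the exhaustion by compact
  intervals over \<open>lebesgue\<close>; for continuous integrands one may switch freely.\<close>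

lemma lborel_set_continuous:
  fixes f :: "real \<Rightarrow> 'a :: {banach, second_countable_topology}"
  assumes "S \<in> sets borel" "continuous_on S f"
  shows "set_integrable lebesgue S f \<longleftrightarrow> set_integrable lborel S f"
    and "(LINT x:S|lebesgue. f x) = (LINT x:S|lborel. f x)"
proof -
  have "(\<lambda>x. indicator S x *\<^sub>R f x) \<in> borel_measurable lborel"
    using borel_measurable_continuous_on_indicator[OF assms] by simp
  then show "set_integrable lebesgue S f \<longleftrightarrow> set_integrable lborel S f"
    and "(LINT x:S|lebesgue. f x) = (LINT x:S|lborel. f x)"
    unfolding set_integrable_def set_lebesgue_integral_def
    by (rule integrable_completion, rule integral_completion)
qed

lemma set_integrable_exp_minus:
  assumes "a > 0"
  shows "set_integrable lborel {0<..} (\<lambda>r::real. exp (- a * r))"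
proof -
  have "(\<lambda>r::real. exp (- a * r)) integrable_on {0..}"
    using has_integral_exp_minus_to_infinity[OF assms, of 0] by (auto simp: integrable_on_def)
  then have "(\<lambda>r::real. exp (- a * r)) absolutely_integrable_on {0..}"
    by (rule nonnegative_absolutely_integrable_1) simp
  then have "set_integrable lebesgue {0<..} (\<lambda>r::real. exp (- a * r))"
    by (rule set_integrable_subset) auto
  then show ?thesis
    by (subst (asm) lborel_set_continuous(1)) (auto intro!: continuous_intros)
qed

lemma integrable_gaussian:
  assumes "a > 0"
  shows "integrable lborel (\<lambda>r::real. exp (- (a * r\<^sup>2)))"
proof -
  have "integrable lborel (\<lambda>r::real. exp (- (0 + sqrt a * r)\<^sup>2))"
    using has_bochner_integral_gaussian assms
    by (intro lborel_integrable_real_affine) (auto simp: has_bochner_integral_iff)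
  then show ?thesis using assms by (simp add: power_mult_distrib)
qed

text \<open>This is the characteristic function of the standard normal distribution at
  \<open>z / c\<close>, after the substitution of \<open>c * k\<close> for its integration
  variable.\<close>

lemma gaussian_fourier:
  assumes \<sigma>: "\<sigma> > 0" and t: "t > 0"
  shows "(LINT k|lborel. exp (\<i> * of_real k * of_real z - of_real ((\<sigma> * k)\<^sup>2 * t))) = 2 * of_real pi * of_real (heat_kernel \<sigma> z t)"
proof -
  \<comment> \<open>With this scale \<open>(c * k)\<^sup>2 / 2 = (\<sigma> * k)\<^sup>2 * t\<close>,
    so the normal density becomes the damping factor.\<close>
  define c where "c = \<sigma> * sqrt (2 * t)"
  have c: "c > 0" using assms by (simp add: c_def)
  have c2: "c\<^sup>2 = 2 * \<sigma>\<^sup>2 * t" using t by (simp add: c_def power_mult_distrib)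
  define I where "I = (LINT k|lborel. exp (\<i> * of_real k * of_real z - of_real ((\<sigma> * k)\<^sup>2 * t)))"
  have "complex_of_real (exp (- ((z / c)\<^sup>2) / 2)) = char std_normal_distribution (z / c)"
    by (simp add: char_std_normal_distribution)
  also have "\<dots> = (LINT x|lborel. std_normal_density x *\<^sub>R iexp (z / c * x))"
    unfolding char_def by (subst integral_density) auto
  also have "\<dots> = \<bar>c\<bar> *\<^sub>R (LINT k|lborel. std_normal_density (0 + c * k) *\<^sub>R iexp (z / c * (0 + c * k)))"
    using c by (intro lborel_integral_real_affine) simp
  also have "(\<lambda>k. std_normal_density (0 + c * k) *\<^sub>R iexp (z / c * (0 + c * k)))
     = (\<lambda>k. of_real (1 / sqrt (2 * pi)) * exp (\<i> * of_real k * of_real z - of_real ((\<sigma> * k)\<^sup>2 * t)))"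
  proof
    fix k
    have 1: "(c * k)\<^sup>2 / 2 = (\<sigma> * k)\<^sup>2 * t" by (simp add: power_mult_distrib c2)
    have 2: "z / c * (0 + c * k) = k * z" using c by simp
    have "std_normal_density (0 + c * k) *\<^sub>R iexp (z / c * (0 + c * k))
      = of_real (1 / sqrt (2 * pi)) * (of_real (exp (- ((\<sigma> * k)\<^sup>2 * t))) * iexp (k * z))"
      unfolding std_normal_density_def 2 by (simp add: 1 scaleR_conv_of_real)
    also have "of_real (exp (- ((\<sigma> * k)\<^sup>2 * t))) * iexp (k * z) = exp (\<i> * of_real k * of_real z - of_real ((\<sigma> * k)\<^sup>2 * t))"
      unfolding exp_of_real[symmetric] exp_add[symmetric] by (simp add: algebra_simps)
    finally show "std_normal_density (0 + c * k) *\<^sub>R iexp (z / c * (0 + c * k))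
      = of_real (1 / sqrt (2 * pi)) * exp (\<i> * of_real k * of_real z - of_real ((\<sigma> * k)\<^sup>2 * t))" .
  qed
  also have "(LINT k|lborel. of_real (1 / sqrt (2 * pi)) * exp (\<i> * of_real k * of_real z - of_real ((\<sigma> * k)\<^sup>2 * t)))
      = of_real (1 / sqrt (2 * pi)) * I"
    unfolding I_def by (rule integral_mult_right_zero)
  finally have "complex_of_real (exp (- ((z / c)\<^sup>2) / 2)) = of_real (c / sqrt (2 * pi)) * I"
    using c by (simp add: scaleR_conv_of_real)
  moreover have "exp (- ((z / c)\<^sup>2) / 2) = (c / sqrt (2 * pi)) * (2 * pi * heat_kernel \<sigma> z t)"
  proof -
    have "- ((z / c)\<^sup>2) / 2 = - z\<^sup>2 / (4 * \<sigma>\<^sup>2 * t)" by (simp add: power_divide c2)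
    moreover have "(c / sqrt (2 * pi)) * (2 * pi) = \<sigma> * sqrt (4 * pi * t)"
    proof -
      have "sqrt (4 * pi * t) = sqrt (2 * t) * sqrt (2 * pi)" by (simp flip: real_sqrt_mult)
      moreover have "2 * pi / sqrt (2 * pi) = sqrt (2 * pi)" by (rule real_div_sqrt) simp
      moreover have "c / sqrt (2 * pi) * (2 * pi) = c * (2 * pi / sqrt (2 * pi))"
        by (simp only: times_divide_eq_left times_divide_eq_right)
      ultimately show ?thesis by (simp only: c_def mult.assoc)
    qed
    ultimately show ?thesis using assms by (simp add: heat_kernel_def mult.assoc[symmetric])
  qed
  ultimately have "of_real (c / sqrt (2 * pi)) * I = of_real (c / sqrt (2 * pi)) * (of_real (2 * pi * heat_kernel \<sigma> z t))"
    by (simp only: of_real_mult)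
  then show ?thesis using c by (simp add: I_def)
qed

section \<open>Rotation of a ray to the real axis\<close>

definition heat_mode :: "real \<Rightarrow> real \<Rightarrow> real \<Rightarrow> complex \<Rightarrow> complex" where
  "heat_mode \<sigma> t z k = exp (\<i> * k * of_real z - (of_real \<sigma> * k)\<^sup>2 * of_real t)"

text \<open>Shows the two sources of decay: the height \<open>Im k\<close> against \<open>z\<close>,
  and the Gaussian, which drops out exactly where \<open>(Re k)\<^sup>2 = (Im k)\<^sup>2\<close>,
  that is on the boundary of D.\<close>

lemma norm_heat_mode: "norm (heat_mode \<sigma> t z k) = exp (- Im k * z - \<sigma>\<^sup>2 * t * ((Re k)\<^sup>2 - (Im k)\<^sup>2))"
proof -
  have "Re (\<i> * k * of_real z - (of_real \<sigma> * k)\<^sup>2 * of_real t) = - Im k * z - \<sigma>\<^sup>2 * t * ((Re k)\<^sup>2 - (Im k)\<^sup>2)"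
    by (simp add: power_mult_distrib Re_power2 Im_power2 algebra_simps flip: of_real_power)
  then show ?thesis unfolding heat_mode_def norm_exp_eq_Re by simp
qed

lemma continuous_on_heat_mode [continuous_intros]:
  "continuous_on A g \<Longrightarrow> continuous_on A h \<Longrightarrow> continuous_on A (\<lambda>x. heat_mode \<sigma> t (h x) (g x))"
  unfolding heat_mode_def by (intro continuous_intros)

lemma cis_pi_4: "cis (pi / 4) = of_real (sqrt 2 / 2) * (1 + \<i>)"
  by (simp add: complex_eq_iff cos_45 sin_45)

text \<open>The integral over the ray at angle \<open>\<pi>/4\<close>, on which the Gaussian factor only oscillates, equals the one
  over the positive real axis: the arc between them can be replaced by the vertical segment from
  \<open>R\<close> to \<open>R + i R\<close>, where the integrand is at most \<open>exp (- R z)\<close>.\<close>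

context
  fixes \<sigma> t z :: real
  assumes \<sigma>: "\<sigma> > 0" and t: "t > 0" and z: "z > 0"
begin

text \<open>The decay is Gaussian on the real axis but only exponential on the ray, where it rests
  on \<open>z > 0\<close>.\<close>

lemma set_integrable_heat_mode:
  "set_integrable lebesgue {0<..} (\<lambda>r. heat_mode \<sigma> t z (of_real r))"
  "set_integrable lebesgue {0<..} (\<lambda>r. heat_mode \<sigma> t z (of_real r * cis (pi / 4)))"
proof -
  have cont: "continuous_on {0<..} (\<lambda>r. heat_mode \<sigma> t z (of_real r * e))" for e
    by (intro continuous_intros)
  have "set_integrable lborel {0<..} (\<lambda>r. heat_mode \<sigma> t z (of_real r))"
    unfolding set_integrable_def
  proof (rule Bochner_Integration.integrable_bound)
    show "integrable lborel (\<lambda>r. exp (- (\<sigma>\<^sup>2 * t * r\<^sup>2)))"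
      using \<sigma> t by (intro integrable_gaussian) simp
    show "(\<lambda>r. indicator {0<..} r *\<^sub>R heat_mode \<sigma> t z (of_real r)) \<in> borel_measurable lborel"
      using borel_measurable_continuous_on_indicator[OF _ cont[of 1]] by simp
    show "AE r in lborel. norm (indicator {0<..} r *\<^sub>R heat_mode \<sigma> t z (of_real r)) \<le> norm (exp (- (\<sigma>\<^sup>2 * t * r\<^sup>2)))"
      by (intro AE_I2) (simp add: norm_heat_mode indicator_def)
  qed
  then show "set_integrable lebesgue {0<..} (\<lambda>r. heat_mode \<sigma> t z (of_real r))"
    using lborel_set_continuous(1)[OF _ cont[of 1]] by simp
  have "set_integrable lborel {0<..} (\<lambda>r. heat_mode \<sigma> t z (of_real r * cis (pi / 4)))"
  proof (rule set_integrable_bound)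
    show "set_integrable lborel {0<..} (\<lambda>r. exp (- (sqrt 2 / 2 * z) * r))"
      using z by (intro set_integrable_exp_minus) simp
    show "set_borel_measurable lborel {0<..} (\<lambda>r. heat_mode \<sigma> t z (of_real r * cis (pi / 4)))"
      unfolding set_borel_measurable_def
      using borel_measurable_continuous_on_indicator[OF _ cont] by simp
    show "AE r in lborel. r \<in> {0<..} \<longrightarrow>
        norm (heat_mode \<sigma> t z (of_real r * cis (pi / 4))) \<le> norm (exp (- (sqrt 2 / 2 * z) * r))"
      by (intro AE_I2) (simp add: norm_heat_mode cis_pi_4 mult_ac)
  qed
  then show "set_integrable lebesgue {0<..} (\<lambda>r. heat_mode \<sigma> t z (of_real r * cis (pi / 4)))"
    using lborel_set_continuous(1)[OF _ cont] by simp
qed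

lemma heat_mode_rotate_ray:
  "(LINT r:{0<..}|lebesgue. heat_mode \<sigma> t z (of_real r * cis (pi / 4)) * cis (pi / 4)) = (LINT r:{0<..}|lebesgue. heat_mode \<sigma> t z (of_real r))"
proof -
  have "heat_mode \<sigma> t z holomorphic_on UNIV" unfolding heat_mode_def by (intro holomorphic_intros)
  \<comment> \<open>The plane is convex, so an entire function has a global primitive, and every
    path integral below is a difference of values of \<open>F\<close>.\<close>
  then obtain F where F: "\<And>k. (F has_field_derivative heat_mode \<sigma> t z k) (at k)"
    using holomorphic_convex_primitive'[OF convex_UNIV open_UNIV] by (metis UNIV_I)
  define c where "c = cis (pi / 4)"
  have ftc: "integral {a..b} (\<lambda>r. heat_mode \<sigma> t z (of_real r * e) * e) = F (of_real b * e) - F (of_real a * e)"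
    if "a \<le> b" for a b :: real and e :: complex
  proof (intro integral_unique fundamental_theorem_of_calculus that)
    fix r :: real
    have "((\<lambda>x. x * e) has_field_derivative e) (at (of_real r))"
      by (auto intro!: derivative_eq_intros)
    from DERIV_chain2[OF F this]
    show "((\<lambda>r. F (of_real r * e)) has_vector_derivative heat_mode \<sigma> t z (of_real r * e) * e) (at r within {a..b})"
      by (rule has_vector_derivative_real_field)
  qed
  define l where "l n = inverse (real (Suc n))" for n
  define r where "r n = real (Suc n)" for n
  have l: "\<And>n. 0 < l n" "l \<longlonglongrightarrow> 0"
    unfolding l_def using LIMSEQ_inverse_real_of_nat by auto
  \<comment> \<open>The factor \<open>sqrt 2\<close> puts the end of the diagonal piece vertically
    above the end of the real interval.\<close>
  have r: "filterlim r at_top sequentially" "filterlim (\<lambda>n. sqrt 2 * r n) at_top sequentially"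
    unfolding r_def by real_asymp+
  have lr: "l n \<le> r n" "l n \<le> sqrt 2 * r n" for n
  proof -
    have "l n \<le> 1" "1 \<le> r n" "1 \<le> sqrt 2 * r n"
      unfolding l_def r_def by (auto simp: inverse_le_1_iff intro: mult_ge1_I[where y = "1 + real n"])
    then show "l n \<le> r n" "l n \<le> sqrt 2 * r n" by linarith+
  qed
  have Fl: "(\<lambda>n. F (of_real (l n) * e)) \<longlonglongrightarrow> F 0" for e
  proof (rule isCont_tendsto_compose[OF DERIV_isCont[OF F]])
    show "(\<lambda>n. of_real (l n) * e) \<longlonglongrightarrow> 0"
      using tendsto_mult[OF tendsto_of_real[OF l(2)] tendsto_const, of e] by simp
  qed
  have 1: "(\<lambda>n. F (of_real (r n)) - F (of_real (l n))) \<longlonglongrightarrow> (LINT r:{0<..}|lebesgue. heat_mode \<sigma> t z (of_real r))"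
    using integral_halfline_exhaust[OF set_integrable_heat_mode(1) l r(1)] ftc[OF lr(1), where e = 1] by simp
  have 2: "(\<lambda>n. F (of_real (sqrt 2 * r n) * c) - F (of_real (l n) * c)) \<longlonglongrightarrow>
      (LINT r:{0<..}|lebesgue. heat_mode \<sigma> t z (of_real r * c) * c)"
  proof -
    have "set_integrable lebesgue {0<..} (\<lambda>r. heat_mode \<sigma> t z (of_real r * c) * c)"
      unfolding c_def by (intro set_integrable_mult_left set_integrable_heat_mode)
    from integral_halfline_exhaust[OF this l r(2)] show ?thesis
      unfolding ftc[OF lr(2)] .
  qed
  have "(\<lambda>n. F (of_real (sqrt 2 * r n) * c) - F (of_real (r n))) \<longlonglongrightarrow> 0"
  proof (rule Lim_null_comparison)
    show "(\<lambda>n. exp (- r n * z) * r n) \<longlonglongrightarrow> 0"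
      unfolding r_def using z by real_asymp
    \<comment> \<open>Beyond this threshold the Gaussian makes up for the missing height in the
      lower part of the vertical segment.\<close>
    have "\<forall>\<^sub>F n in sequentially. r n \<ge> z / (\<sigma>\<^sup>2 * t)"
      using r(1) by (simp add: filterlim_at_top)
    then show "\<forall>\<^sub>F n in sequentially. norm (F (of_real (sqrt 2 * r n) * c) - F (of_real (r n))) \<le> exp (- r n * z) * r n"
    proof eventually_elim
      case (elim n)
      define R where "R = r n"
      have R: "R > 0" "z \<le> \<sigma>\<^sup>2 * t * R"
        using elim \<sigma> t by (auto simp: R_def r_def field_simps)
      have corner: "of_real (sqrt 2 * R) * c = Complex R R"
        by (simp add: c_def cis_pi_4 complex_eq_iff)
      have "norm (F (Complex R R) - F (of_real R)) \<le> exp (- R * z) * norm (Complex R R - of_real R)"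
      proof (rule field_differentiable_bound[of "closed_segment (of_real R) (Complex R R)" F "heat_mode \<sigma> t z"])
        show "(F has_field_derivative heat_mode \<sigma> t z k) (at k within closed_segment (of_real R) (Complex R R))" for k
          using F by (rule has_field_derivative_at_within)
        fix k assume "k \<in> closed_segment (of_real R) (Complex R R)"
        then obtain u where u: "0 \<le> u" "u \<le> 1" "k = (1 - u) *\<^sub>R of_real R + u *\<^sub>R Complex R R"
          by (auto simp: in_segment)
        define q where "q = u * R"
        have k: "Re k = R" "Im k = q" unfolding u(3) by (simp_all add: q_def algebra_simps)
        have q: "0 \<le> q" "q \<le> R" using u R by (auto simp: q_def intro: mult_left_le_one_le)
        \<comment> \<open>At height \<open>q\<close> the factor \<open>exp (- q * z)\<close> falls
          short of the target by \<open>(R - q) * z\<close> in the exponent, whereas the Gaussian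
          supplies \<open>\<sigma>\<^sup>2 * t * (R - q) * (R + q)\<close>.\<close>
        have "(R - q) * z \<le> (R - q) * (\<sigma>\<^sup>2 * t * (R + q))"
        proof (rule mult_left_mono)
          have "\<sigma>\<^sup>2 * t * R \<le> \<sigma>\<^sup>2 * t * (R + q)" using q t by (intro mult_left_mono) auto
          then show "z \<le> \<sigma>\<^sup>2 * t * (R + q)" using R(2) by linarith
        qed (use q in simp)
        then have "- q * z - \<sigma>\<^sup>2 * t * (R\<^sup>2 - q\<^sup>2) \<le> - R * z"
          by (simp add: algebra_simps power2_eq_square)
        then show "norm (heat_mode \<sigma> t z k) \<le> exp (- R * z)" by (simp add: norm_heat_mode k)
      qed auto
      also have "norm (Complex R R - of_real R) = R"
        using R by (simp add: complex_diff[symmetric] complex_norm Complex_eq norm_mult)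
      finally show ?case unfolding R_def[symmetric] corner .
    qed
  qed
  moreover have "(\<lambda>n. F (of_real (sqrt 2 * r n) * c) - F (of_real (r n))) \<longlonglongrightarrow>
     (LINT r:{0<..}|lebesgue. heat_mode \<sigma> t z (of_real r * c) * c) - (LINT r:{0<..}|lebesgue. heat_mode \<sigma> t z (of_real r))"
    using tendsto_diff[OF tendsto_add[OF 2 Fl[of c]] tendsto_add[OF 1 Fl[of 1]]] by simp
  ultimately have "(LINT r:{0<..}|lebesgue. heat_mode \<sigma> t z (of_real r * c) * c) - (LINT r:{0<..}|lebesgue. heat_mode \<sigma> t z (of_real r)) = 0"
    by (rule LIMSEQ_unique[rotated])
  then show ?thesis by (simp add: c_def)
qed

end

section \<open>Contour integrals of modes and of transforms\<close>

lemma cis_3pi_4: "cis (3 * pi / 4) = - cnj (cis (pi / 4))"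
proof -
  have "cis (3 * pi / 4) = cis (pi + - (pi / 4))" by (rule arg_cong[where f = cis]) simp
  also have "\<dots> = cis pi * cis (- (pi / 4))" by (rule cis_mult[symmetric])
  finally show ?thesis by (simp add: cis_cnj)
qed

lemma ray_integral_uminus: "ray_integral \<theta> (\<lambda>k. - f k) = - ray_integral \<theta> f"
  unfolding ray_integral_def set_lebesgue_integral_def Bochner_Integration.integral_minus[symmetric]
  by (rule Bochner_Integration.integral_cong) simp_all

lemma ray_integral_opposite:
  assumes "cis \<phi> = - cis \<theta>"
  shows "ray_integral \<phi> f = - ray_integral \<theta> (\<lambda>k. f (- k))"
  unfolding ray_integral_def set_lebesgue_integral_def Bochner_Integration.integral_minus[symmetric] assms
  by (rule Bochner_Integration.integral_cong) simp_all

text \<open>Rotation turns the right ray into the integral \<open>I\<close> over the positive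
  half-axis, and by symmetry the left ray gives \<open>- cnj I\<close>. The contour integral
  \<open>I + cnj I\<close> is thus the Fourier integral of the Gaussian over the whole line.\<close>

lemma integral_bdry_D_upper_heat_mode:
  assumes \<sigma>: "\<sigma> > 0" and t: "t > 0" and z: "z > 0"
  shows "integral_bdry_D_upper (heat_mode \<sigma> t z) = 2 * of_real pi * of_real (heat_kernel \<sigma> z t)"
proof -
  let ?f = "heat_mode \<sigma> t z"
  \<comment> \<open>Symmetry under reflection in the imaginary axis, which interchanges the two
    rays.\<close>
  have cnj_f: "?f (- cnj k) = cnj (?f k)" for k
    by (simp add: heat_mode_def exp_cnj)
  define I where "I = (LINT r:{0<..}|lborel. ?f (of_real r))"
  have cont: "continuous_on {0<..} (\<lambda>r. ?f (of_real r * e) * e)" for e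
    by (intro continuous_intros)
  have "ray_integral (pi / 4) ?f = (LINT r:{0<..}|lebesgue. ?f (of_real r * cis (pi / 4)) * cis (pi / 4))"
    unfolding ray_integral_def by (rule lborel_set_continuous(2)[OF _ cont, symmetric]) simp
  also have "\<dots> = (LINT r:{0<..}|lebesgue. ?f (of_real r))"
    by (rule heat_mode_rotate_ray[OF assms])
  also have "\<dots> = I"
    unfolding I_def using lborel_set_continuous(2)[OF _ cont[of 1]] by simp
  finally have 1: "ray_integral (pi / 4) ?f = I" .
  have "ray_integral (3 * pi / 4) ?f = (LINT r:{0<..}|lborel. - cnj (?f (of_real r * cis (pi / 4)) * cis (pi / 4)))"
    unfolding ray_integral_def cis_3pi_4
    using cnj_f[of "of_real r * cis (pi / 4)" for r] by simp
  also have "\<dots> = - cnj (ray_integral (pi / 4) ?f)"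
    unfolding ray_integral_def set_lebesgue_integral_def Bochner_Integration.integral_cnj[symmetric]
      Bochner_Integration.integral_minus[symmetric]
    by (rule Bochner_Integration.integral_cong) simp_all
  finally have 2: "ray_integral (3 * pi / 4) ?f = - cnj I" unfolding 1 .
  have int: "set_integrable lborel {0<..} (\<lambda>r. ?f (of_real r))"
    using set_integrable_heat_mode(1)[OF assms] lborel_set_continuous(1)[OF _ cont[of 1]] by simp
  have int': "set_integrable lborel {0<..} (\<lambda>r. cnj (?f (of_real r)))"
    using integrable_cnj[OF int[unfolded set_integrable_def]] by (simp add: set_integrable_def)
  have cI: "cnj I = (LINT r:{0<..}|lborel. cnj (?f (of_real r)))"
    unfolding I_def set_lebesgue_integral_def Bochner_Integration.integral_cnj[symmetric]
    by (rule Bochner_Integration.integral_cong) simp_all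
  \<comment> \<open>By the same symmetry the negative half-axis contributes
    \<open>cnj I\<close>.\<close>
  have refl: "integrable lborel (\<lambda>r. indicator {..<0} r *\<^sub>R ?f (of_real r))"
      "(LINT r|lborel. indicator {..<0} r *\<^sub>R ?f (of_real r)) = cnj I"
  proof -
    have eq: "indicator {..<0} (0 + (- 1) * r) *\<^sub>R ?f (of_real (0 + (- 1) * r)) = indicator {0<..} r *\<^sub>R cnj (?f (of_real r))" for r :: real
      using cnj_f[of "of_real r"] by (auto simp: indicator_def)
    show "integrable lborel (\<lambda>r. indicator {..<0} r *\<^sub>R ?f (of_real r))"
      using int' unfolding lborel_integrable_real_affine_iff[of "- 1" "\<lambda>r. indicator {..<0} r *\<^sub>R ?f (of_real r)" 0, symmetric, simplified]
      using eq by (simp add: set_integrable_def)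
    show "(LINT r|lborel. indicator {..<0} r *\<^sub>R ?f (of_real r)) = cnj I"
      by (subst lborel_integral_real_affine[of "- 1" _ 0]) (use eq in \<open>simp_all add: cI set_lebesgue_integral_def\<close>)
  qed
  have "I + cnj I = (LINT r|lborel. indicator {0<..} r *\<^sub>R ?f (of_real r) + indicator {..<0} r *\<^sub>R ?f (of_real r))"
    using int refl unfolding I_def set_lebesgue_integral_def set_integrable_def by simp
  also have "\<dots> = (LINT r|lborel. ?f (of_real r))"
  proof (rule integral_cong_AE)
    show "AE r in lborel. indicator {0<..} r *\<^sub>R ?f (of_real r) + indicator {..<0} r *\<^sub>R ?f (of_real r) = ?f (of_real r)"
      using AE_lborel_singleton[of 0] by eventually_elim (auto simp: indicator_def)
    have [measurable]: "(\<lambda>r. ?f (of_real r)) \<in> borel_measurable borel"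
      by (intro borel_measurable_continuous_onI continuous_intros)
    show "(\<lambda>r. indicator {0<..} r *\<^sub>R ?f (of_real r) + indicator {..<0} r *\<^sub>R ?f (of_real r)) \<in> borel_measurable lborel"
      "(\<lambda>r. ?f (of_real r)) \<in> borel_measurable lborel"
      by simp_all
  qed
  also have "\<dots> = 2 * of_real pi * of_real (heat_kernel \<sigma> z t)"
    using gaussian_fourier[OF \<sigma> t, of z] by (simp add: heat_mode_def power_mult_distrib)
  finally show ?thesis by (simp add: integral_bdry_D_upper_def 1 2)
qed

text \<open>Written out, the transform merges with the exponential into a mode at
  \<open>l * y + x > 0\<close>, whose contour integral is known for each \<open>y\<close>; what
  remains is Fubini. The reflected term has \<open>l = 1\<close>, the transmitted one
  \<open>l = \<sigma> / \<rho>\<close>.\<close>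

lemma integral_bdry_D_upper_transform:
  assumes \<sigma>: "\<sigma> > 0" and t: "t > 0" and x: "x > 0" and l: "l > 0"
    and w: "set_integrable lebesgue {0<..} w"
  shows "integral_bdry_D_upper (\<lambda>k. C * exp (\<i> * k * of_real x - (of_real \<sigma> * k)\<^sup>2 * of_real t)
        * half_line_transform {0<..} w (- (k * of_real l)))
    = C * (2 * of_real pi * of_real (LINT y:{0<..}|lebesgue. heat_kernel \<sigma> (l * y + x) t * w y))"
proof -
  define g where "g e r y = heat_mode \<sigma> t (l * y + x) (of_real r * e) * e" for e r y
  \<comment> \<open>Both rays meet the conditions on \<theta>. Equal squares of real and imaginary
    part make the Gaussian factor unimodular, and the positive imaginary part gives the majorant
    \<open>exp (- (sqrt 2 / 2 * x) * r)\<close>, uniform in \<open>y\<close>.\<close>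
  have ray: "ray_integral \<theta> (\<lambda>k. C * exp (\<i> * k * of_real x - (of_real \<sigma> * k)\<^sup>2 * of_real t)
        * half_line_transform {0<..} w (- (k * of_real l)))
      = C * (LINT y:{0<..}|lebesgue. ray_integral \<theta> (heat_mode \<sigma> t (l * y + x)) * of_real (w y))"
    and ray_int: "set_integrable lebesgue {0<..} (\<lambda>y. ray_integral \<theta> (heat_mode \<sigma> t (l * y + x)) * of_real (w y))"
    if \<theta>: "Im (cis \<theta>) = sqrt 2 / 2" "\<bar>Re (cis \<theta>)\<bar> = sqrt 2 / 2" for \<theta>
  proof -
    let ?e = "cis \<theta>"
    have cont: "continuous_on UNIV (\<lambda>(r, y). g ?e r y)"
      unfolding g_def split_beta' by (intro continuous_intros)
    have bound: "norm (g ?e r y) \<le> exp (- (sqrt 2 / 2 * x) * r)" if "r \<in> {0<..}" "y > 0" for r y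
    proof -
      have "(Re ?e)\<^sup>2 = (Im ?e)\<^sup>2"
        using arg_cong[OF \<theta>(2), of "\<lambda>a. a\<^sup>2"] unfolding \<theta>(1) by simp
      then have sq: "(Re (of_real r * ?e))\<^sup>2 = (Im (of_real r * ?e))\<^sup>2"
        by (simp add: power_mult_distrib)
      have im: "Im (of_real r * ?e) = r * (sqrt 2 / 2)"
        using \<theta>(1) by simp
      have "norm (g ?e r y) = exp (- (r * (sqrt 2 / 2)) * (l * y + x))"
        unfolding g_def norm_mult norm_heat_mode sq im by simp
      also have "\<dots> \<le> exp (- (sqrt 2 / 2 * x) * r)"
        using that l by (simp add: algebra_simps)
      finally show ?thesis .
    qed
    have h: "set_integrable lborel {0<..} (\<lambda>r. exp (- (sqrt 2 / 2 * x) * r))"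
      using x by (intro set_integrable_exp_minus) simp
    have S: "{0::real<..} \<in> sets borel" by simp
    have ray_eq: "(LINT r:{0<..}|lborel. g ?e r y) = ray_integral \<theta> (heat_mode \<sigma> t (l * y + x))" for y
      by (simp only: ray_integral_def g_def)
    have fub: "(LINT r:{0<..}|lborel. LINT y:{0<..}|lebesgue. g ?e r y * of_real (w y))
      = (LINT y:{0<..}|lebesgue. ray_integral \<theta> (heat_mode \<sigma> t (l * y + x)) * of_real (w y))"
      unfolding ray_eq[symmetric] by (rule fubini_kernel[OF cont S h _ w]) (rule bound)
    have "ray_integral \<theta> (\<lambda>k. C * exp (\<i> * k * of_real x - (of_real \<sigma> * k)\<^sup>2 * of_real t)
        * half_line_transform {0<..} w (- (k * of_real l)))
      = (LINT r:{0<..}|lborel. C * (LINT y:{0<..}|lebesgue. g ?e r y * of_real (w y)))"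
      unfolding ray_integral_def
    proof (intro set_lebesgue_integral_cong allI impI)
      fix r
      define k where "k = of_real r * ?e"
      have "exp (\<i> * k * of_real x - (of_real \<sigma> * k)\<^sup>2 * of_real t) * half_line_transform {0<..} w (- (k * of_real l)) * ?e
        = (LINT y:{0<..}|lebesgue. (exp (\<i> * k * of_real x - (of_real \<sigma> * k)\<^sup>2 * of_real t) * ?e) *
            (exp (- (\<i> * (- (k * of_real l)) * of_real y)) * of_real (w y)))"
        unfolding half_line_transform_def by (subst set_integral_mult_right) simp
      also have "\<dots> = (LINT y:{0<..}|lebesgue. g ?e r y * of_real (w y))"
      proof (intro set_lebesgue_integral_cong allI impI)
        fix y
        have "exp (\<i> * k * of_real x - (of_real \<sigma> * k)\<^sup>2 * of_real t) * exp (- (\<i> * (- (k * of_real l)) * of_real y))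
          = heat_mode \<sigma> t (l * y + x) k"
          unfolding heat_mode_def exp_add[symmetric] by (simp add: algebra_simps)
        then show "(exp (\<i> * k * of_real x - (of_real \<sigma> * k)\<^sup>2 * of_real t) * ?e) *
            (exp (- (\<i> * (- (k * of_real l)) * of_real y)) * of_real (w y)) = g ?e r y * of_real (w y)"
          by (simp add: g_def k_def mult_ac)
      qed simp
      finally show "C * exp (\<i> * (of_real r * ?e) * of_real x - (of_real \<sigma> * (of_real r * ?e))\<^sup>2 * of_real t)
          * half_line_transform {0<..} w (- (of_real r * ?e * of_real l)) * ?e
          = C * (LINT y:{0<..}|lebesgue. g ?e r y * of_real (w y))"
        by (simp add: k_def mult.assoc)
    qed simp
    also have "\<dots> = C * (LINT r:{0<..}|lborel. LINT y:{0<..}|lebesgue. g ?e r y * of_real (w y))"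
      by (rule set_integral_mult_right)
    finally show "ray_integral \<theta> (\<lambda>k. C * exp (\<i> * k * of_real x - (of_real \<sigma> * k)\<^sup>2 * of_real t)
        * half_line_transform {0<..} w (- (k * of_real l)))
      = C * (LINT y:{0<..}|lebesgue. ray_integral \<theta> (heat_mode \<sigma> t (l * y + x)) * of_real (w y))"
      unfolding fub .
    show "set_integrable lebesgue {0<..} (\<lambda>y. ray_integral \<theta> (heat_mode \<sigma> t (l * y + x)) * of_real (w y))"
      unfolding ray_eq[symmetric] by (rule fubini_kernel_integrable[OF cont S h _ w]) (rule bound)
  qed
  have a1: "Im (cis (pi / 4)) = sqrt 2 / 2" "\<bar>Re (cis (pi / 4))\<bar> = sqrt 2 / 2"
    by (simp_all add: cos_45 sin_45)
  have a2: "Im (cis (3 * pi / 4)) = sqrt 2 / 2" "\<bar>Re (cis (3 * pi / 4))\<bar> = sqrt 2 / 2"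
    unfolding cis_3pi_4 by (simp_all add: cos_45 sin_45)
  have "integral_bdry_D_upper (\<lambda>k. C * exp (\<i> * k * of_real x - (of_real \<sigma> * k)\<^sup>2 * of_real t)
        * half_line_transform {0<..} w (- (k * of_real l)))
      = C * (LINT y:{0<..}|lebesgue. ray_integral (pi / 4) (heat_mode \<sigma> t (l * y + x)) * of_real (w y)
          - ray_integral (3 * pi / 4) (heat_mode \<sigma> t (l * y + x)) * of_real (w y))"
    unfolding integral_bdry_D_upper_def ray[OF a1] ray[OF a2]
    by (subst set_integral_diff(2)[OF ray_int[OF a1] ray_int[OF a2]]) (simp add: right_diff_distrib)
  also have "(LINT y:{0<..}|lebesgue. ray_integral (pi / 4) (heat_mode \<sigma> t (l * y + x)) * of_real (w y)
          - ray_integral (3 * pi / 4) (heat_mode \<sigma> t (l * y + x)) * of_real (w y))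
      = (LINT y:{0<..}|lebesgue. of_real (2 * pi * (heat_kernel \<sigma> (l * y + x) t * w y)))"
  proof (intro set_lebesgue_integral_cong allI impI)
    fix y :: real assume "y \<in> {0<..}"
    then have "l * y + x > 0" using l x by (simp add: add_pos_pos)
    from integral_bdry_D_upper_heat_mode[OF \<sigma> t this]
    show "ray_integral (pi / 4) (heat_mode \<sigma> t (l * y + x)) * of_real (w y)
        - ray_integral (3 * pi / 4) (heat_mode \<sigma> t (l * y + x)) * of_real (w y)
      = of_real (2 * pi * (heat_kernel \<sigma> (l * y + x) t * w y))"
      by (simp add: integral_bdry_D_upper_def flip: left_diff_distrib)
  qed simp
  also have "\<dots> = 2 * of_real pi * of_real (LINT y:{0<..}|lebesgue. heat_kernel \<sigma> (l * y + x) t * w y)"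
    unfolding set_integral_complex_of_real set_integral_mult_right by simp
  finally show ?thesis .
qed

text \<open>The Gaussian factor makes the double integral absolutely convergent for every real
  \<open>x\<close>, so Fubini reduces the claim to \<open>gaussian_fourier\<close> at
  \<open>x - y\<close>.\<close>

lemma fourier_inversion_transform:
  assumes \<sigma>: "\<sigma> > 0" and t: "t > 0" and w: "set_integrable lebesgue {0<..} w"
  shows "1 / (2 * of_real pi) * (LINT k|lborel. exp (\<i> * of_real k * of_real x - of_real ((\<sigma> * k)\<^sup>2 * t))
        * half_line_transform {0<..} w (of_real k))
    = of_real (LINT y:{0<..}|lebesgue. heat_kernel \<sigma> (y - x) t * w y)"
proof -
  define g where "g k y = exp (\<i> * of_real k * of_real (x - y) - of_real ((\<sigma> * k)\<^sup>2 * t))" for k y :: real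
  have cont: "continuous_on UNIV (\<lambda>(k, y). g k y)"
    unfolding g_def split_beta' by (intro continuous_intros)
  have bound: "norm (g k y) \<le> exp (- (\<sigma>\<^sup>2 * t * k\<^sup>2))" for k y
    unfolding g_def norm_exp_eq_Re by (simp add: power_mult_distrib)
  have h: "set_integrable lborel UNIV (\<lambda>k. exp (- (\<sigma>\<^sup>2 * t * k\<^sup>2)))"
    using integrable_gaussian[of "\<sigma>\<^sup>2 * t"] \<sigma> t by (simp add: set_integrable_def)
  have "(LINT k|lborel. exp (\<i> * of_real k * of_real x - of_real ((\<sigma> * k)\<^sup>2 * t)) * half_line_transform {0<..} w (of_real k))
      = (LINT k:UNIV|lborel. LINT y:{0<..}|lebesgue. g k y * of_real (w y))"
  proof -
    have "exp (\<i> * of_real k * of_real x - of_real ((\<sigma> * k)\<^sup>2 * t)) * half_line_transform {0<..} w (of_real k)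
      = (LINT y:{0<..}|lebesgue. g k y * of_real (w y))" for k
    proof -
      have "exp (\<i> * of_real k * of_real x - of_real ((\<sigma> * k)\<^sup>2 * t)) * half_line_transform {0<..} w (of_real k)
        = (LINT y:{0<..}|lebesgue. exp (\<i> * of_real k * of_real x - of_real ((\<sigma> * k)\<^sup>2 * t)) *
            (exp (- (\<i> * of_real k * of_real y)) * of_real (w y)))"
        unfolding half_line_transform_def by (rule set_integral_mult_right[symmetric])
      also have "\<dots> = (LINT y:{0<..}|lebesgue. g k y * of_real (w y))"
      proof (intro set_lebesgue_integral_cong allI impI)
        fix y :: real
        have "exp (\<i> * of_real k * of_real x - of_real ((\<sigma> * k)\<^sup>2 * t)) * exp (- (\<i> * of_real k * of_real y)) = g k y"
          unfolding g_def exp_add[symmetric] by (simp add: algebra_simps)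
        then show "exp (\<i> * of_real k * of_real x - of_real ((\<sigma> * k)\<^sup>2 * t)) *
            (exp (- (\<i> * of_real k * of_real y)) * of_real (w y)) = g k y * of_real (w y)"
          by (simp add: mult.assoc[symmetric])
      qed simp
      finally show ?thesis .
    qed
    then show ?thesis by (simp add: set_lebesgue_integral_def[of lborel])
  qed
  also have "\<dots> = (LINT y:{0<..}|lebesgue. (LINT k:UNIV|lborel. g k y) * of_real (w y))"
    by (rule fubini_kernel[OF cont _ h bound w]) simp
  also have "\<dots> = (LINT y:{0<..}|lebesgue. of_real (2 * pi * (heat_kernel \<sigma> (y - x) t * w y)))"
  proof (intro set_lebesgue_integral_cong allI impI)
    fix y :: real
    have "(LINT k:UNIV|lborel. g k y) = 2 * of_real pi * of_real (heat_kernel \<sigma> (x - y) t)"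
      using gaussian_fourier[OF \<sigma> t, of "x - y"] by (simp add: g_def set_lebesgue_integral_def)
    moreover have "heat_kernel \<sigma> (x - y) t = heat_kernel \<sigma> (y - x) t"
      using heat_kernel_minus(1)[of \<sigma> "x - y" t] by simp
    ultimately show "(LINT k:UNIV|lborel. g k y) * of_real (w y) = of_real (2 * pi * (heat_kernel \<sigma> (y - x) t * w y))"
      by simp
  qed simp
  also have "\<dots> = 2 * of_real pi * of_real (LINT y:{0<..}|lebesgue. heat_kernel \<sigma> (y - x) t * w y)"
    unfolding set_integral_complex_of_real set_integral_mult_right by simp
  finally show ?thesis by simp
qed

text \<open>The half-turn \<open>k \<mapsto> - k\<close> maps one oriented contour to the other; the
  minus sign is that of the differential.\<close>

lemma integral_bdry_D_lower_eq_upper: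
  "integral_bdry_D_lower f = - integral_bdry_D_upper (\<lambda>k. f (- k))"
proof -
  have "cis (- (3 * pi / 4)) = - cis (pi / 4)" "cis (- (pi / 4)) = - cis (3 * pi / 4)"
    unfolding cis_3pi_4 by (simp_all add: cis_3pi_4 cis_cnj flip: cis_cnj)
  then show ?thesis
    by (simp add: integral_bdry_D_lower_def integral_bdry_D_upper_def ray_integral_opposite)
qed

section \<open>Assembly of the two formulas\<close>

lemma half_line_transform_left:
  "half_line_transform {..<0} v k = half_line_transform {0<..} (\<lambda>x. v (- x)) (- k)"
  unfolding half_line_transform_def lebesgue_set_integral_reflect by simp

text \<open>The direct, reflected and transmitted integrals of
  \<open>interface_representation\<close> in Fourier form; the factor \<open>2 * pi\<close> of a
  contour integral converts the constants into the two coefficients. \<open>v0\<close> and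
  \<open>w0\<close> match the initial values on the open half-line, which is all the integrals
  see.\<close>

lemma interface_transform_formula:
  assumes A: "half_line_flow \<sigma> v vx vt vxx" and B: "half_line_flow \<rho> w wx wt wxx"
    and jump: "\<And>t. t > 0 \<Longrightarrow> w 0 t = v 0 t + \<gamma>"
    and flux: "\<And>t. t > 0 \<Longrightarrow> \<rho>\<^sup>2 * wx 0 t = - (\<sigma>\<^sup>2 * vx 0 t)"
    and x: "x > 0" and t: "t > 0"
    and v0: "\<And>y. y > 0 \<Longrightarrow> v y 0 = v0 y" and w0: "\<And>y. y > 0 \<Longrightarrow> w y 0 = w0 y"
  shows "complex_of_real (v x t) =
      of_real (- (\<rho> * \<gamma> / (\<sigma> + \<rho>)) * (1 - erf (x / (2 * sqrt (\<sigma>\<^sup>2 * t)))))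
      + 1 / (2 * of_real pi) * (LINT k|lborel. exp (\<i> * of_real k * of_real x - of_real ((\<sigma> * k)\<^sup>2 * t))
          * half_line_transform {0<..} v0 (of_real k))
      + integral_bdry_D_upper (\<lambda>k. of_real ((\<sigma> - \<rho>) / (2 * pi * (\<sigma> + \<rho>))) *
          exp (\<i> * k * of_real x - (of_real \<sigma> * k)\<^sup>2 * of_real t) * half_line_transform {0<..} v0 (- k))
      + integral_bdry_D_upper (\<lambda>k. of_real (\<sigma> / (pi * (\<sigma> + \<rho>))) *
          exp (\<i> * k * of_real x - (of_real \<sigma> * k)\<^sup>2 * of_real t) * half_line_transform {0<..} w0 (- (k * of_real (\<sigma> / \<rho>))))"
proof -
  note pos = half_line_flow.\<sigma>[OF A] half_line_flow.\<sigma>[OF B]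
  have "set_integrable lebesgue {0<..} (\<lambda>y. v y 0) = set_integrable lebesgue {0<..} v0"
    "set_integrable lebesgue {0<..} (\<lambda>y. w y 0) = set_integrable lebesgue {0<..} w0"
    by (intro set_integrable_cong; simp add: v0 w0)+
  then have int: "set_integrable lebesgue {0<..} v0" "set_integrable lebesgue {0<..} w0"
    using half_line_flow.int_v[OF A, of 0] half_line_flow.int_v[OF B, of 0] by simp_all
  have eq: "(LINT y:{0<..}|lebesgue. K y * v y 0) = (LINT y:{0<..}|lebesgue. K y * v0 y)"
    "(LINT y:{0<..}|lebesgue. K y * w y 0) = (LINT y:{0<..}|lebesgue. K y * w0 y)" for K
    by (intro set_lebesgue_integral_cong; simp add: v0 w0)+
  define I where "I = (LINT y:{0<..}|lebesgue. heat_kernel \<sigma> (y + x) t * v0 y)"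
  define J where "J = (LINT y:{0<..}|lebesgue. heat_kernel \<sigma> (\<sigma> / \<rho> * y + x) t * w0 y)"
  have "integral_bdry_D_upper (\<lambda>k. of_real ((\<sigma> - \<rho>) / (2 * pi * (\<sigma> + \<rho>))) *
          exp (\<i> * k * of_real x - (of_real \<sigma> * k)\<^sup>2 * of_real t) * half_line_transform {0<..} v0 (- k))
      = of_real ((\<sigma> - \<rho>) / (2 * pi * (\<sigma> + \<rho>))) * (2 * of_real pi * of_real I)"
    using integral_bdry_D_upper_transform[OF pos(1) t x zero_less_one int(1), of "of_real ((\<sigma> - \<rho>) / (2 * pi * (\<sigma> + \<rho>)))"]
    unfolding I_def by (simp only: of_real_1 mult_1_left mult_1_right)
  also have "\<dots> = of_real ((\<sigma> - \<rho>) / (2 * pi * (\<sigma> + \<rho>)) * (2 * pi) * I)" by simp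
  also have "(\<sigma> - \<rho>) / (2 * pi * (\<sigma> + \<rho>)) * (2 * pi) = (\<sigma> - \<rho>) / (\<sigma> + \<rho>)" by simp
  finally have 1: "integral_bdry_D_upper (\<lambda>k. of_real ((\<sigma> - \<rho>) / (2 * pi * (\<sigma> + \<rho>))) *
          exp (\<i> * k * of_real x - (of_real \<sigma> * k)\<^sup>2 * of_real t) * half_line_transform {0<..} v0 (- k))
      = of_real ((\<sigma> - \<rho>) / (\<sigma> + \<rho>) * I)" .
  have "integral_bdry_D_upper (\<lambda>k. of_real (\<sigma> / (pi * (\<sigma> + \<rho>))) *
          exp (\<i> * k * of_real x - (of_real \<sigma> * k)\<^sup>2 * of_real t) * half_line_transform {0<..} w0 (- (k * of_real (\<sigma> / \<rho>))))
      = of_real (\<sigma> / (pi * (\<sigma> + \<rho>))) * (2 * of_real pi * of_real J)"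
    unfolding J_def by (rule integral_bdry_D_upper_transform[OF pos(1) t x divide_pos_pos[OF pos] int(2)])
  also have "\<dots> = of_real (\<sigma> / (pi * (\<sigma> + \<rho>)) * (2 * pi) * J)" by simp
  also have "\<sigma> / (pi * (\<sigma> + \<rho>)) * (2 * pi) = 2 * \<sigma> / (\<sigma> + \<rho>)" by simp
  finally have 2: "integral_bdry_D_upper (\<lambda>k. of_real (\<sigma> / (pi * (\<sigma> + \<rho>))) *
          exp (\<i> * k * of_real x - (of_real \<sigma> * k)\<^sup>2 * of_real t) * half_line_transform {0<..} w0 (- (k * of_real (\<sigma> / \<rho>))))
      = of_real (2 * \<sigma> / (\<sigma> + \<rho>) * J)" .
  have "v x t = - (\<rho> * \<gamma> / (\<sigma> + \<rho>)) * (1 - erf (x / (2 * sqrt (\<sigma>\<^sup>2 * t))))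
      + (LINT y:{0<..}|lebesgue. heat_kernel \<sigma> (y - x) t * v0 y)
      + (\<sigma> - \<rho>) / (\<sigma> + \<rho>) * I + 2 * \<sigma> / (\<sigma> + \<rho>) * J"
    unfolding I_def J_def eq[symmetric]
    by (rule interface_representation[OF A B _ _ x t]) (use jump flux in auto)
  then show ?thesis
    unfolding fourier_inversion_transform[OF pos(1) t int(1)] 1 2 by (simp only: of_real_add)
qed

theorem proposition1:
  fixes \<sigma>L \<sigma>R \<gamma>L \<gamma>R :: real
    and u0L u0R :: "real \<Rightarrow> real"
    and uL uR :: "real \<Rightarrow> real \<Rightarrow> real"
    and vhatL vhatR :: "complex \<Rightarrow> complex"
  defines "vhatL \<equiv> half_line_transform {..<0} (\<lambda>x. u0L x - \<gamma>L)"
    and "vhatR \<equiv> half_line_transform {0<..} (\<lambda>x. u0R x - \<gamma>R)"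
  assumes "\<sigma>L > 0" and "\<sigma>R > 0"
    and "(\<lambda>x. u0L x - \<gamma>L) absolutely_integrable_on {..<0}"
    and "(\<lambda>x. u0R x - \<gamma>R) absolutely_integrable_on {0<..}"
    and "heat_interface_solution \<sigma>L \<sigma>R \<gamma>L \<gamma>R u0L u0R uL uR"
  shows "(\<forall>x<0. \<forall>t>0. complex_of_real (uL x t) =
      of_real (\<gamma>L + \<sigma>R * (\<gamma>R - \<gamma>L) / (\<sigma>L + \<sigma>R) * (1 + erf (x / (2 * sqrt (\<sigma>L\<^sup>2 * t)))))
      + 1 / (2 * of_real pi) *
          (LINT k|lborel. exp (\<i> * of_real k * of_real x - of_real ((\<sigma>L * k)\<^sup>2 * t)) * vhatL (of_real k))
      + integral_bdry_D_lower (\<lambda>k. of_real ((\<sigma>R - \<sigma>L) / (2 * pi * (\<sigma>L + \<sigma>R))) *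
          exp (\<i> * k * of_real x - (of_real \<sigma>L * k)\<^sup>2 * of_real t) * vhatL (- k))
      - integral_bdry_D_lower (\<lambda>k. of_real (\<sigma>L / (pi * (\<sigma>L + \<sigma>R))) *
          exp (\<i> * k * of_real x - (of_real \<sigma>L * k)\<^sup>2 * of_real t) * vhatR (k * of_real (\<sigma>L / \<sigma>R)))) \<and>
    (\<forall>x>0. \<forall>t>0. complex_of_real (uR x t) =
      of_real (\<gamma>R + \<sigma>L * (\<gamma>L - \<gamma>R) / (\<sigma>L + \<sigma>R) * (1 - erf (x / (2 * sqrt (\<sigma>R\<^sup>2 * t)))))
      + 1 / (2 * of_real pi) *
          (LINT k|lborel. exp (\<i> * of_real k * of_real x - of_real ((\<sigma>R * k)\<^sup>2 * t)) * vhatR (of_real k))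
      + integral_bdry_D_upper (\<lambda>k. of_real ((\<sigma>R - \<sigma>L) / (2 * pi * (\<sigma>L + \<sigma>R))) *
          exp (\<i> * k * of_real x - (of_real \<sigma>R * k)\<^sup>2 * of_real t) * vhatR (- k))
      + integral_bdry_D_upper (\<lambda>k. of_real (\<sigma>R / (pi * (\<sigma>L + \<sigma>R))) *
          exp (\<i> * k * of_real x - (of_real \<sigma>R * k)\<^sup>2 * of_real t) * vhatL (k * of_real (\<sigma>R / \<sigma>L))))"
proof -
  obtain uLx uRx where L: "half_line_heat_solution {..<0} at_bot \<sigma>L \<gamma>L u0L uL uLx"
    and R: "half_line_heat_solution {0<..} at_top \<sigma>R \<gamma>R u0R uR uRx"
    and iface: "\<And>t. t > 0 \<Longrightarrow> uL 0 t = uR 0 t \<and> \<sigma>L\<^sup>2 * uLx 0 t = \<sigma>R\<^sup>2 * uRx 0 t"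
    using assms(7) unfolding heat_interface_solution_def by blast
  obtain vtL vxxL where A: "half_line_flow \<sigma>L (\<lambda>x t. uL (- x) t - \<gamma>L) (\<lambda>x t. - uLx (- x) t) vtL vxxL"
    using half_line_flow_left[OF \<open>\<sigma>L > 0\<close> L] .
  obtain vtR vxxR where B: "half_line_flow \<sigma>R (\<lambda>x t. uR x t - \<gamma>R) uRx vtR vxxR"
    using half_line_flow_right[OF \<open>\<sigma>R > 0\<close> R] .
  have initL: "uL (- y) 0 - \<gamma>L = u0L (- y) - \<gamma>L" if "y > 0" for y
    using half_line_heat_solutionD(5)[OF L, of "- y"] that by simp
  have initR: "uR y 0 - \<gamma>R = u0R y - \<gamma>R" if "y > 0" for y
    using half_line_heat_solutionD(5)[OF R, of y] that by simp
  define hL where "hL = half_line_transform {0<..} (\<lambda>y. u0L (- y) - \<gamma>L)"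
  have vhatL: "vhatL k = hL (- k)" for k
    unfolding vhatL_def hL_def by (rule half_line_transform_left)
  show ?thesis
  proof (intro conjI allI impI)
    fix x t :: real assume x: "x > 0" and t: "t > 0"
    \<comment> \<open>The right side plays the role of \<open>v\<close>. Since \<open>uL\<close> and
      \<open>uR\<close> agree at the interface, the jump constant is
      \<open>\<gamma>R - \<gamma>L\<close>.\<close>
    have "complex_of_real (uR x t - \<gamma>R) =
        of_real (- (\<sigma>L * (\<gamma>R - \<gamma>L) / (\<sigma>R + \<sigma>L)) * (1 - erf (x / (2 * sqrt (\<sigma>R\<^sup>2 * t)))))
        + 1 / (2 * of_real pi) * (LINT k|lborel. exp (\<i> * of_real k * of_real x - of_real ((\<sigma>R * k)\<^sup>2 * t)) * vhatR (of_real k))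
        + integral_bdry_D_upper (\<lambda>k. of_real ((\<sigma>R - \<sigma>L) / (2 * pi * (\<sigma>R + \<sigma>L))) *
            exp (\<i> * k * of_real x - (of_real \<sigma>R * k)\<^sup>2 * of_real t) * vhatR (- k))
        + integral_bdry_D_upper (\<lambda>k. of_real (\<sigma>R / (pi * (\<sigma>R + \<sigma>L))) *
            exp (\<i> * k * of_real x - (of_real \<sigma>R * k)\<^sup>2 * of_real t) * vhatL (k * of_real (\<sigma>R / \<sigma>L)))"
      unfolding vhatL unfolding vhatR_def hL_def
      by (rule interface_transform_formula[OF B A _ _ x t initR initL]) (use iface in auto)
    moreover have "complex_of_real (uR x t) = of_real \<gamma>R + complex_of_real (uR x t - \<gamma>R)" by simp
    moreover have "- (\<sigma>L * (\<gamma>R - \<gamma>L) / (\<sigma>L + \<sigma>R)) = \<sigma>L * (\<gamma>L - \<gamma>R) / (\<sigma>L + \<sigma>R)"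
      by (simp add: minus_divide_left algebra_simps)
    ultimately show "complex_of_real (uR x t) =
      of_real (\<gamma>R + \<sigma>L * (\<gamma>L - \<gamma>R) / (\<sigma>L + \<sigma>R) * (1 - erf (x / (2 * sqrt (\<sigma>R\<^sup>2 * t)))))
      + 1 / (2 * of_real pi) *
          (LINT k|lborel. exp (\<i> * of_real k * of_real x - of_real ((\<sigma>R * k)\<^sup>2 * t)) * vhatR (of_real k))
      + integral_bdry_D_upper (\<lambda>k. of_real ((\<sigma>R - \<sigma>L) / (2 * pi * (\<sigma>L + \<sigma>R))) *
          exp (\<i> * k * of_real x - (of_real \<sigma>R * k)\<^sup>2 * of_real t) * vhatR (- k))
      + integral_bdry_D_upper (\<lambda>k. of_real (\<sigma>R / (pi * (\<sigma>L + \<sigma>R))) *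
          exp (\<i> * k * of_real x - (of_real \<sigma>R * k)\<^sup>2 * of_real t) * vhatL (k * of_real (\<sigma>R / \<sigma>L)))"
      unfolding add.commute[of \<sigma>R \<sigma>L] by (simp only: of_real_add add.assoc)
  next
    fix x t :: real assume x: "x < 0" and t: "t > 0"
    have x': "- x > 0" using x by simp
    have 1: "complex_of_real (uL (- (- x)) t - \<gamma>L) =
        of_real (- (\<sigma>R * (\<gamma>L - \<gamma>R) / (\<sigma>L + \<sigma>R)) * (1 - erf (- x / (2 * sqrt (\<sigma>L\<^sup>2 * t)))))
        + 1 / (2 * of_real pi) * (LINT k|lborel. exp (\<i> * of_real k * of_real (- x) - of_real ((\<sigma>L * k)\<^sup>2 * t)) * hL (of_real k))
        + integral_bdry_D_upper (\<lambda>k. of_real ((\<sigma>L - \<sigma>R) / (2 * pi * (\<sigma>L + \<sigma>R))) *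
            exp (\<i> * k * of_real (- x) - (of_real \<sigma>L * k)\<^sup>2 * of_real t) * hL (- k))
        + integral_bdry_D_upper (\<lambda>k. of_real (\<sigma>L / (pi * (\<sigma>L + \<sigma>R))) *
            exp (\<i> * k * of_real (- x) - (of_real \<sigma>L * k)\<^sup>2 * of_real t) * vhatR (- (k * of_real (\<sigma>L / \<sigma>R))))"
      unfolding vhatR_def hL_def
      by (rule interface_transform_formula[OF A B _ _ x' t initL initR]) (use iface in auto)
    have 2: "(LINT k|lborel. exp (\<i> * of_real k * of_real (- x) - of_real ((\<sigma>L * k)\<^sup>2 * t)) * hL (of_real k))
      = (LINT k|lborel. exp (\<i> * of_real k * of_real x - of_real ((\<sigma>L * k)\<^sup>2 * t)) * vhatL (of_real k))"
      by (subst lborel_integral_real_affine[of "- 1" _ 0]) (simp_all add: vhatL)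
    \<comment> \<open>The minus sign from exchanging the contours turns
      \<open>\<sigma>L - \<sigma>R\<close> into \<open>\<sigma>R - \<sigma>L\<close>.\<close>
    have 3: "integral_bdry_D_upper (\<lambda>k. of_real ((\<sigma>L - \<sigma>R) / (2 * pi * (\<sigma>L + \<sigma>R))) *
            exp (\<i> * k * of_real (- x) - (of_real \<sigma>L * k)\<^sup>2 * of_real t) * hL (- k))
       = integral_bdry_D_lower (\<lambda>k. of_real ((\<sigma>R - \<sigma>L) / (2 * pi * (\<sigma>L + \<sigma>R))) *
          exp (\<i> * k * of_real x - (of_real \<sigma>L * k)\<^sup>2 * of_real t) * vhatL (- k))"
    proof -
      have neg: "- integral_bdry_D_upper f = integral_bdry_D_upper (\<lambda>k. - f k)" for f
        by (simp add: integral_bdry_D_upper_def ray_integral_uminus)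
      have "of_real ((\<sigma>L - \<sigma>R) / (2 * pi * (\<sigma>L + \<sigma>R))) = - complex_of_real ((\<sigma>R - \<sigma>L) / (2 * pi * (\<sigma>L + \<sigma>R)))"
        unfolding of_real_minus[symmetric] minus_divide_left by simp
      then show ?thesis
        unfolding integral_bdry_D_lower_eq_upper neg vhatL by simp
    qed
    \<comment> \<open>Here the same sign stays outside, which explains the subtraction of the last
      term for \<open>uL\<close>.\<close>
    have 4: "integral_bdry_D_upper (\<lambda>k. of_real (\<sigma>L / (pi * (\<sigma>L + \<sigma>R))) *
            exp (\<i> * k * of_real (- x) - (of_real \<sigma>L * k)\<^sup>2 * of_real t) * vhatR (- (k * of_real (\<sigma>L / \<sigma>R))))
       = - integral_bdry_D_lower (\<lambda>k. of_real (\<sigma>L / (pi * (\<sigma>L + \<sigma>R))) *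
          exp (\<i> * k * of_real x - (of_real \<sigma>L * k)\<^sup>2 * of_real t) * vhatR (k * of_real (\<sigma>L / \<sigma>R)))"
      unfolding integral_bdry_D_lower_eq_upper by simp
    have 5: "- (\<sigma>R * (\<gamma>L - \<gamma>R) / (\<sigma>L + \<sigma>R)) * (1 - erf (- x / (2 * sqrt (\<sigma>L\<^sup>2 * t))))
      = \<sigma>R * (\<gamma>R - \<gamma>L) / (\<sigma>L + \<sigma>R) * (1 + erf (x / (2 * sqrt (\<sigma>L\<^sup>2 * t))))"
      unfolding minus_divide_left[symmetric] erf_minus by (simp add: minus_divide_left algebra_simps)
    have "complex_of_real (uL x t) = of_real \<gamma>L + complex_of_real (uL (- (- x)) t - \<gamma>L)" by simp
    then show "complex_of_real (uL x t) =
      of_real (\<gamma>L + \<sigma>R * (\<gamma>R - \<gamma>L) / (\<sigma>L + \<sigma>R) * (1 + erf (x / (2 * sqrt (\<sigma>L\<^sup>2 * t)))))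
      + 1 / (2 * of_real pi) *
          (LINT k|lborel. exp (\<i> * of_real k * of_real x - of_real ((\<sigma>L * k)\<^sup>2 * t)) * vhatL (of_real k))
      + integral_bdry_D_lower (\<lambda>k. of_real ((\<sigma>R - \<sigma>L) / (2 * pi * (\<sigma>L + \<sigma>R))) *
          exp (\<i> * k * of_real x - (of_real \<sigma>L * k)\<^sup>2 * of_real t) * vhatL (- k))
      - integral_bdry_D_lower (\<lambda>k. of_real (\<sigma>L / (pi * (\<sigma>L + \<sigma>R))) *
          exp (\<i> * k * of_real x - (of_real \<sigma>L * k)\<^sup>2 * of_real t) * vhatR (k * of_real (\<sigma>L / \<sigma>R)))"
      unfolding 1 2 3 4 5 by (simp only: of_real_add add.assoc diff_conv_add_uminus)
  qed
qed

end
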